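(* Let $n=2m$ with $m>1$ odd, let $S\subseteq\mathbb{Z}_n$ with $S=-S$, $0\notin S$, and let $\Gamma=\mathrm{Cay}(\mathbb{Z}_n,S)$ be connected, non-bipartite, reduced and unstable, such that the orbit of the vertex $(0,1)$ under the stabilizer of $(0,0)$ in $\mathrm{Aut}(\Gamma\times K_2)$ is exactly $\{(0,1),(m,1)\}$. Let $B\le\mathbb{Z}_n$ be as defined below. Suppose there exists a subgroup $\widetilde B\le\mathbb{Z}_n$ such that the partition $\widetilde{\mathcal B}$ of $\mathbb{Z}_n$ into cosets of $\widetilde B$ is a block system for $\mathrm{Aut}^\pi(\Gamma)$ which is minimal (with respect to refinement) among the block systems for $\mathrm{Aut}^\pi(\Gamma)$ strictly coarser than the partition $\mathcal B$ into cosets of $B$, and suppose that both pairs $(\Gamma_{\mathrm{reflective}},B)$ and $(\Gamma_{\mathrm{reflective}},\widetilde B)$ satisfy the replacement property. Then $\mathrm{Cay}(\mathbb{Z}_{n},S)\cong\mathrm{Cay}(\mathbb{Z}_{n},S+m)$.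
   Context: $\mathrm{Cay}(\mathbb{Z}_n,S)$ has vertex set $\mathbb{Z}_n$ with $x\sim y$ iff $y-x\in S$; $\Gamma\times K_2$ has vertex set $\mathbb{Z}_n\times\{0,1\}$ with $(x,i)\sim(y,j)$ iff $y-x\in S$, $i\ne j$. $\Gamma$ is reduced if distinct vertices have distinct neighbourhoods; unstable if some automorphism of $\Gamma\times K_2$ is not of the form $(v,i)\mapsto(\varphi(v),\psi(i))$ with $\varphi\in\mathrm{Aut}(\Gamma)$, $\psi\in\mathrm{Sym}\{0,1\}$. A two-fold automorphism is $(\sigma_1,\sigma_2)\in\mathrm{Sym}(\mathbb{Z}_n)^2$ with $y-x\in S\iff\sigma_2(y)-\sigma_1(x)\in S$; $\mathrm{Aut}^\pi(\Gamma)$ is the group of all such $\sigma_1$; for reduced $\Gamma$, $\sigma_2=:\gamma(\sigma_1)$ is unique, and $\alpha(\tau)=\tau^{-1}\circ\gamma(\tau)$. A block system for $\mathrm{Aut}^\pi(\Gamma)$ is a partition of $\mathbb{Z}_n$ whose parts are permuted by every element of $\mathrm{Aut}^\pi(\Gamma)$. Define $x\sim y$ iff $\alpha(\sigma)(x)-x=\alpha(\sigma)(y)-y$ for all $\sigma\in\mathrm{Aut}^\pi(\Gamma)$; under the hypotheses above the equivalence class $B$ of $0$ is a subgroup of $\mathbb{Z}_n$, the classes are its cosets, and $\mathcal B$ is the coarsest partition on each part of which every $x\mapsto\alpha(\sigma)(x)-x$ is constant. $S_r=\{s\in S\mid s+m\in S\}$ and $\Gamma_{\mathrm{reflective}}=\mathrm{Cay}(\mathbb{Z}_n,S_r)$.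 For a Cayley graph $\Sigma=\mathrm{Cay}(\mathbb{Z}_n,T)$ and $H\le\mathbb{Z}_n$, with $\mathcal H$ the partition into cosets of $H$ and $\mathrm{Aut}_{\mathcal H}(\Sigma)$ the automorphisms fixing each coset setwise, $(\Sigma,H)$ satisfies the replacement property if there is $f:\mathcal H\to\mathbb{Z}_n$ with $f(H)=0$ such that for every $\sigma\in\mathrm{Aut}_{\mathcal H}(\Sigma)$ there is $\widetilde\sigma\in\mathrm{Aut}_{\mathcal H}(\Sigma)$ with $\widetilde\sigma(x)=\sigma(x-f(\mathfrak h))+f(\mathfrak h)$ for all $\mathfrak h\in\mathcal H$, $x\in\mathfrak h$ (in particular $f(\mathfrak h)\in\mathfrak h$). *)

theory Defs
  imports
    "HOL-Algebra.Elementary_Groups"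
    "HOL-Combinatorics.Permutations"
    "HOL-Library.Disjoint_Sets"
    "Graph_Theory.Pair_Digraph"
    "Graph_Theory.Digraph_Isomorphism"
begin

section \<open>Graphs\<close>

text \<open>
  A graph is a pair digraph of the Graph Theory library whose arc relation is symmetric. Loops are
  not excluded by the type: a connection set containing 0 gives a Cayley graph with loops.
  Automorphisms and other permutations of the vertex set are functions that are the identity
  outside the vertex set (\<open>permutes\<close>), so composition and \<open>inv_into UNIV\<close> are the group operations.
\<close>

definition graph_aut :: "'a pair_pre_digraph \<Rightarrow> ('a \<Rightarrow> 'a) set" where
  "graph_aut G = {f. f permutes pverts G \<and>
     (\<forall>x\<in>pverts G. \<forall>y\<in>pverts G. (x, y) \<in> parcs G \<longleftrightarrow> (f x, f y) \<in> parcs G)}"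

definition bipartite :: "'a pair_pre_digraph \<Rightarrow> bool" where
  "bipartite G \<longleftrightarrow> (\<exists>U W. U \<union> W = pverts G \<and> U \<inter> W = {} \<and> parcs G \<subseteq> U \<times> W \<union> W \<times> U)"

definition reduced :: "'a pair_pre_digraph \<Rightarrow> bool" where
  "reduced G \<longleftrightarrow> inj_on (\<lambda>x. parcs G `` {x}) (pverts G)"

definition times_K2 :: "'a pair_pre_digraph \<Rightarrow> ('a \<times> nat) pair_pre_digraph" where
  "times_K2 G = \<lparr>pverts = pverts G \<times> {0, 1},
     parcs = {((x, i), (y, j)) | x i y j. (x, y) \<in> parcs G \<and> i \<in> {0, 1} \<and> j \<in> {0, 1} \<and> i \<noteq> j}\<rparr>"

definition unstable :: "'a pair_pre_digraph \<Rightarrow> bool" where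
  "unstable G \<longleftrightarrow> (\<exists>h\<in>graph_aut (times_K2 G).
     \<not> (\<exists>\<phi>\<in>graph_aut G. \<exists>\<psi>. \<psi> permutes {0, 1} \<and>
          (\<forall>v\<in>pverts G. \<forall>i\<in>{0, 1}. h (v, i) = (\<phi> v, \<psi> i))))"

definition two_fold_aut :: "'a pair_pre_digraph \<Rightarrow> ('a \<Rightarrow> 'a) \<Rightarrow> ('a \<Rightarrow> 'a) \<Rightarrow> bool" where
  "two_fold_aut G \<sigma>\<^sub>1 \<sigma>\<^sub>2 \<longleftrightarrow> \<sigma>\<^sub>1 permutes pverts G \<and> \<sigma>\<^sub>2 permutes pverts G \<and>
     (\<forall>x\<in>pverts G. \<forall>y\<in>pverts G. (x, y) \<in> parcs G \<longleftrightarrow> (\<sigma>\<^sub>1 x, \<sigma>\<^sub>2 y) \<in> parcs G)"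

definition Aut_pi :: "'a pair_pre_digraph \<Rightarrow> ('a \<Rightarrow> 'a) set" where
  "Aut_pi G = {\<sigma>\<^sub>1. \<exists>\<sigma>\<^sub>2. two_fold_aut G \<sigma>\<^sub>1 \<sigma>\<^sub>2}"

text \<open>Only meaningful for reduced \<open>G\<close>, where the second component is unique.\<close>

definition gamma :: "'a pair_pre_digraph \<Rightarrow> ('a \<Rightarrow> 'a) \<Rightarrow> 'a \<Rightarrow> 'a" where
  "gamma G \<sigma>\<^sub>1 = (THE \<sigma>\<^sub>2. two_fold_aut G \<sigma>\<^sub>1 \<sigma>\<^sub>2)"

definition alpha :: "'a pair_pre_digraph \<Rightarrow> ('a \<Rightarrow> 'a) \<Rightarrow> 'a \<Rightarrow> 'a" where
  "alpha G \<tau> = inv_into UNIV \<tau> \<circ> gamma G \<tau>"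

definition block_system :: "'a set \<Rightarrow> ('a \<Rightarrow> 'a) set \<Rightarrow> 'a set set \<Rightarrow> bool" where
  "block_system V K P \<longleftrightarrow> partition_on V P \<and> (\<forall>\<sigma>\<in>K. bij_betw ((`) \<sigma>) P P)"

section \<open>Circulant graphs\<close>

text \<open>The cyclic group of order \<open>n > 0\<close> has the carrier \<open>{0..<int n}\<close>, with arithmetic modulo \<open>n\<close>.\<close>

abbreviation ZMod :: "nat \<Rightarrow> int monoid" where
  "ZMod n \<equiv> integer_mod_group n"

definition Cay :: "nat \<Rightarrow> int set \<Rightarrow> int pair_pre_digraph" where
  "Cay n S = \<lparr>pverts = carrier (ZMod n),
     parcs = {(x, y). x \<in> carrier (ZMod n) \<and> y \<in> carrier (ZMod n) \<and> (y - x) mod int n \<in> S}\<rparr>"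

definition displacement_rel :: "nat \<Rightarrow> int set \<Rightarrow> int rel" where
  "displacement_rel n S = {(x, y). x \<in> carrier (ZMod n) \<and> y \<in> carrier (ZMod n) \<and>
     (\<forall>\<sigma>\<in>Aut_pi (Cay n S).
        (alpha (Cay n S) \<sigma> x - x) mod int n = (alpha (Cay n S) \<sigma> y - y) mod int n)}"

definition B_class :: "nat \<Rightarrow> int set \<Rightarrow> int set" where
  "B_class n S = displacement_rel n S `` {0}"

definition reflective_set :: "nat \<Rightarrow> nat \<Rightarrow> int set \<Rightarrow> int set" where
  "reflective_set n m S = {s \<in> S. (s + int m) mod int n \<in> S}"

definition coset_fixing_aut :: "nat \<Rightarrow> int set \<Rightarrow> int set \<Rightarrow> (int \<Rightarrow> int) set" where
  "coset_fixing_aut n T H = {\<sigma> \<in> graph_aut (Cay n T). \<forall>h\<in>rcosets\<^bsub>ZMod n\<^esub> H. \<sigma> ` h = h}"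

text \<open>
  The map \<open>f\<close> chooses a representative of each coset. The condition \<open>f h \<in> h\<close> is a genuine part
  of the definition; without it, \<open>f = (\<lambda>_. 0)\<close> would always do.
\<close>

definition replacement_property :: "nat \<Rightarrow> int set \<Rightarrow> int set \<Rightarrow> bool" where
  "replacement_property n T H \<longleftrightarrow>
     (\<exists>f. (\<forall>h\<in>rcosets\<^bsub>ZMod n\<^esub> H. f h \<in> h) \<and> f H = 0 \<and>
        (\<forall>\<sigma>\<in>coset_fixing_aut n T H. \<exists>\<sigma>'\<in>coset_fixing_aut n T H.
           \<forall>h\<in>rcosets\<^bsub>ZMod n\<^esub> H. \<forall>x\<in>h.
             \<sigma>' x = (\<sigma> ((x - f h) mod int n) + f h) mod int n))"

end

theory Submission
  imports Defs
begin

text \<open>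
  An isomorphism onto \<open>Cay(S + m)\<close> is a two-fold automorphism whose second component is the first
  one translated by \<open>m\<close>. The orbit hypothesis makes every two-fold automorphism \<open>(\<sigma>, \<gamma> \<sigma>)\<close> of the
  form \<open>\<gamma> \<sigma> = \<sigma> + m w\<close> with a cocycle \<open>w = w \<sigma>\<close> valued in \<open>{0, 1}\<close>, and \<open>B\<close> consists of the
  common periods of all \<open>w\<close>. Edges between different cosets of \<open>B\<close> are reflective. Hence by the
  replacement property it suffices to find an automorphism of the reflective graph which fixes the
  cosets of \<open>B\<close> (or of \<open>Bt\<close>) and acts on that subgroup as a two-fold automorphism with \<open>w = 1\<close>.

  Let \<open>C\<close> be the group of automorphisms of the reflective graph fixing all cosets of \<open>B\<close>. For
  two cosets of \<open>B\<close> in the same coset of \<open>Bt\<close>, the pointwise stabilizer in \<open>C\<close> of the first one has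
  as orbits on the second one the cosets of a subgroup of \<open>B\<close>. The replacement property
  for \<open>B\<close> and the minimality of \<open>Bt\<close> force this subgroup \<open>L\<close> to be the same for all pairs, and
  modulo \<open>L\<close> the group \<open>C\<close> acts in the same way on all cosets of \<open>B\<close> inside \<open>Bt\<close>. It
  follows that the conjugate of a translation by an element of \<open>Bt\<close> by a \<open>\<sigma>\<close> fixing the cosets
  of \<open>Bt\<close> agrees, on each coset of \<open>B\<close> in \<open>Bt\<close> and modulo \<open>L\<close>, with an element of \<open>C\<close> up to
  translation. If the cocycle of one of these conjugated translations is nonzero somewhere on \<open>Bt\<close>,
  then gluing it on \<open>B\<close> with that element of \<open>C\<close> on the rest of \<open>Bt\<close> and spreading the result by
  the replacement property for \<open>Bt\<close> gives the map wanted for \<open>B\<close>. Otherwise every \<open>\<sigma>\<close> fixing the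
  cosets of \<open>Bt\<close> has a constant \<open>w\<close> on \<open>Bt\<close>, and since \<open>Bt\<close> is strictly larger than \<open>B\<close>, this
  constant is 1 for some \<open>\<sigma>\<close>, which is the map wanted for \<open>Bt\<close>.
\<close>

section \<open>Subgroups and permutations of the integers periodic modulo n\<close>

abbreviation finv :: "('a \<Rightarrow> 'b) \<Rightarrow> 'b \<Rightarrow> 'a" where
  "finv \<equiv> inv_into UNIV"

text \<open>These are the preimages in the integers of the subgroups of the cyclic group of order
  \<open>n\<close>.\<close>

definition period_subgroup :: "int \<Rightarrow> int set \<Rightarrow> bool" where
  "period_subgroup n H \<longleftrightarrow> 0 \<in> H \<and> n \<in> H \<and> (\<forall>a\<in>H. \<forall>b\<in>H. a - b \<in> H)"

lemma psg_zero: "period_subgroup n H \<Longrightarrow> 0 \<in> H"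
  and psg_period: "period_subgroup n H \<Longrightarrow> n \<in> H"
  and psg_diff: "period_subgroup n H \<Longrightarrow> a \<in> H \<Longrightarrow> b \<in> H \<Longrightarrow> a - b \<in> H"
  by (auto simp: period_subgroup_def)

lemma psg_uminus: "period_subgroup n H \<Longrightarrow> a \<in> H \<Longrightarrow> - a \<in> H"
  using psg_diff[of n H 0 a] by (simp add: psg_zero)

lemma psg_add: "period_subgroup n H \<Longrightarrow> a \<in> H \<Longrightarrow> b \<in> H \<Longrightarrow> a + b \<in> H"
  using psg_diff[of n H a "- b"] by (simp add: psg_uminus)

lemma psg_uminus_iff: "period_subgroup n H \<Longrightarrow> - a \<in> H \<longleftrightarrow> a \<in> H"
  using psg_uminus[of n H a] psg_uminus[of n H "- a"] by auto

lemma psg_add_left: "period_subgroup n H \<Longrightarrow> a \<in> H \<Longrightarrow> a + b \<in> H \<longleftrightarrow> b \<in> H"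
  using psg_add[of n H a b] psg_diff[of n H "a + b" a] by auto

lemma psg_add_right: "period_subgroup n H \<Longrightarrow> b \<in> H \<Longrightarrow> a + b \<in> H \<longleftrightarrow> a \<in> H"
  using psg_add_left[of n H b a] by (simp add: add.commute)

lemma psg_cong: "period_subgroup n H \<Longrightarrow> a - b \<in> H \<Longrightarrow> a \<in> H \<longleftrightarrow> b \<in> H"
  using psg_add_left[of n H "a - b" b] by simp

lemma psg_flip: "period_subgroup n H \<Longrightarrow> a - b \<in> H \<longleftrightarrow> b - a \<in> H"
  using psg_uminus_iff[of n H "a - b"] by simp

lemma psg_trans:
  assumes "period_subgroup n H" "a - b \<in> H" "b - c \<in> H" shows "a - c \<in> H"
  using psg_add[OF assms] by simp

lemma psg_mult:
  assumes "period_subgroup n H" "a \<in> H" shows "k * a \<in> H"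
proof (induction k rule: int_induct[where k = 0])
  case base then show ?case using psg_zero[OF assms(1)] by simp
next
  case (step1 i) then show ?case using psg_add[OF assms(1) _ assms(2), of "i * a"] by (simp add: distrib_right)
next
  case (step2 i) then show ?case using psg_diff[OF assms(1) _ assms(2), of "i * a"] by (simp add: left_diff_distrib)
qed

lemma psg_dvd: "period_subgroup n H \<Longrightarrow> n dvd a \<Longrightarrow> a \<in> H"
  using psg_mult psg_period by (metis dvd_def mult.commute)

lemma psg_multiples: "period_subgroup n {a. n dvd a}"
  by (auto simp: period_subgroup_def)

text \<open>Division with remainder by the least positive element \<open>d\<close>, which exists
  because \<open>n\<close> is positive and lies in \<open>H\<close>.\<close>

lemma psg_generator:
  assumes "0 < n" and H: "period_subgroup n H"
  obtains d where "0 < d" "d dvd n" "H = {a. d dvd a}"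
proof -
  define d where "d = int (LEAST k. 0 < k \<and> int k \<in> H)"
  have "0 < nat n \<and> int (nat n) \<in> H" using assms psg_period by simp
  then have d: "0 < d" "d \<in> H" unfolding d_def by (metis (mono_tags, lifting) LeastI of_nat_0_less_iff)+
  have "d dvd a" if "a \<in> H" for a
  proof (rule ccontr)
    assume "\<not> d dvd a"
    then have pos: "0 < a mod d" using d(1) by (simp add: dvd_eq_mod_eq_0 order_less_le)
    have "a mod d = a - a div d * d" by (simp add: minus_div_mult_eq_mod)
    then have "a mod d \<in> H" using psg_diff[OF H that psg_mult[OF H d(2)]] by simp
    then have "d \<le> a mod d"
      unfolding d_def using pos Least_le[of "\<lambda>k. 0 < k \<and> int k \<in> H" "nat (a mod d)"] d_def by simp
    then show False using pos_mod_bound[OF d(1), of a] by simp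
  qed
  moreover have "a \<in> H" if "d dvd a" for a using that psg_mult[OF H d(2)] by (metis dvd_def mult.commute)
  ultimately have "H = {a. d dvd a}" by auto
  then show thesis using that d psg_period[OF H] by auto
qed

lemma card_multiples:
  fixes n d :: int
  assumes "0 < n" "0 < d" "d dvd n"
  shows "card ({a. d dvd a} \<inter> {0..<n}) = nat (n div d)"
proof -
  obtain k where k: "n = d * k" using assms(3) by auto
  have "{a. d dvd a} \<inter> {0..<n} = (\<lambda>i. d * i) ` {0..<k}"
    using assms k by (auto simp: dvd_def zero_le_mult_iff image_iff)
  moreover have "inj_on (\<lambda>i. d * i) {0..<k}" using assms(2) by (auto simp: inj_on_def)
  ultimately show ?thesis using assms k by (simp add: card_image)
qed

text \<open>A cyclic group has at most one subgroup of each order, since the order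
  \<open>n div d\<close> determines the generator \<open>d\<close>. This turns equal orbit sizes
  into equal orbits.\<close>

lemma psg_eq_if_card_eq:
  assumes "0 < n" "period_subgroup n H" "period_subgroup n H'"
    and eq: "card (H \<inter> {0..<n}) = card (H' \<inter> {0..<n})"
  shows "H = H'"
proof -
  obtain d where d: "0 < d" "d dvd n" "H = {a. d dvd a}" using psg_generator[OF assms(1,2)] .
  obtain d' where d': "0 < d'" "d' dvd n" "H' = {a. d' dvd a}" using psg_generator[OF assms(1,3)] .
  have "nat (n div d) = nat (n div d')" using eq card_multiples d d' assms(1) by metis
  moreover have "0 < n div d" "0 < n div d'" using assms(1) d d' by (auto simp: pos_imp_zdiv_pos_iff zdvd_imp_le)
  ultimately have "n div d = n div d'" by simp
  then have "d = d'" using d d' assms(1) by (metis dvd_mult_div_cancel less_irrefl mult_right_cancel mult_zero_right)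
  then show ?thesis using d d' by simp
qed

lemma dvd_diff_imp_shift:
  fixes x y n :: int
  assumes "n dvd x - y" obtains k where "x = y + k * n"
proof -
  from assms obtain k where "x - y = n * k" by (rule dvdE)
  then show thesis by (intro that[of k]) (simp add: algebra_simps)
qed

lemma periodic_int:
  fixes g :: "int \<Rightarrow> 'a" and n :: int
  assumes "\<And>x. g (x + n) = g x" shows "g (x + k * n) = g x"
proof -
  have *: "g (x + int j * n) = g x" for j x
  proof (induction j)
    case (Suc j)
    have "x + int (Suc j) * n = x + int j * n + n" by (simp add: algebra_simps)
    then show ?case using Suc assms by metis
  qed simp
  show ?thesis
  proof (cases "0 \<le> k")
    case True then show ?thesis using *[of x "nat k"] by simp
  next
    case False then show ?thesis using *[of "x + k * n" "nat (- k)"] by simp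
  qed
qed

text \<open>
  A permutation of the integers modulo \<open>n\<close> is represented by a lift to the integers, which commutes
  with the translation by \<open>n\<close>. Subsets of the cyclic group become \<open>n\<close>-periodic subsets, so that
  differences need no reduction; the lift is unique only up to multiples of \<open>n\<close>.
\<close>

definition Per :: "int \<Rightarrow> (int \<Rightarrow> int) set" where
  "Per n = {\<sigma>. bij \<sigma> \<and> (\<forall>x. \<sigma> (x + n) = \<sigma> x + n)}"

lemma Per_bij: "\<sigma> \<in> Per n \<Longrightarrow> bij \<sigma>"
  by (simp add: Per_def)

lemma Per_inv_right [simp]: "\<sigma> \<in> Per n \<Longrightarrow> \<sigma> (finv \<sigma> x) = x"
  and Per_inv_left [simp]: "\<sigma> \<in> Per n \<Longrightarrow> finv \<sigma> (\<sigma> x) = x"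
  by (simp_all add: Per_def bij_is_surj surj_f_inv_f bij_is_inj)

lemma Per_shift: assumes "\<sigma> \<in> Per n" shows "\<sigma> (x + k * n) = \<sigma> x + k * n"
  using periodic_int[of "\<lambda>x. \<sigma> x - x" n x k] assms by (simp add: Per_def)

text \<open>Equality holds, not only congruence, because a lift commutes exactly with adding
  multiples of \<open>n\<close>.\<close>

lemma Per_diff: "\<sigma> \<in> Per n \<Longrightarrow> n dvd x - y \<Longrightarrow> \<sigma> x - \<sigma> y = x - y"
  by (erule dvd_diff_imp_shift) (simp add: Per_shift)

lemma Per_cong: "\<sigma> \<in> Per n \<Longrightarrow> n dvd x - y \<Longrightarrow> n dvd \<sigma> x - \<sigma> y"
  using Per_diff by metis

lemma Per_trans: "(\<lambda>x. x + a) \<in> Per n"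
  by (auto simp: Per_def bij_def inj_on_def intro!: surjI[of _ "\<lambda>x. x - a"])

lemma Per_comp: "\<sigma> \<in> Per n \<Longrightarrow> \<tau> \<in> Per n \<Longrightarrow> (\<lambda>x. \<sigma> (\<tau> x)) \<in> Per n"
  using bij_comp[of \<tau> \<sigma>] by (auto simp: Per_def comp_def)

lemma Per_inv: assumes "\<sigma> \<in> Per n" shows "finv \<sigma> \<in> Per n"
proof -
  have "finv \<sigma> (x + n) = finv \<sigma> x + n" for x
  proof -
    have "\<sigma> (finv \<sigma> x + n) = x + n" using assms by (simp add: Per_def bij_is_surj surj_f_inv_f)
    then show ?thesis using assms by (metis Per_inv_left)
  qed
  then show ?thesis using assms by (simp add: Per_def bij_imp_bij_inv)
qed

section \<open>Two-fold automorphisms of a circulant graph, lifted to the integers\<close>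

locale circulant =
  fixes m :: int and S :: "int set"
  assumes m_pos: "0 < m"
    and S_period: "s + 2 * m \<in> S \<longleftrightarrow> s \<in> S"
    and S_sym: "- s \<in> S \<longleftrightarrow> s \<in> S"
begin

abbreviation n :: int where "n \<equiv> 2 * m"

text \<open>Boolean cocycle values turn the addition of the displacements 0 and \<open>m\<close>
  modulo \<open>n\<close> into exclusive or.\<close>

definition half :: "bool \<Rightarrow> int" where "half w = (if w then m else 0)"

definition Sr :: "int set" where "Sr = {s \<in> S. s + m \<in> S}"

lemma S_shift: "s + k * n \<in> S \<longleftrightarrow> s \<in> S"
  using periodic_int[of "\<lambda>x. x \<in> S" n] S_period by blast

lemma S_cong: "n dvd a - b \<Longrightarrow> a \<in> S \<longleftrightarrow> b \<in> S"
  by (erule dvd_diff_imp_shift) (simp add: S_shift)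

lemma S_flip: "a - b \<in> S \<longleftrightarrow> b - a \<in> S"
  using S_sym[of "a - b"] by simp

lemma Sr_cong: "n dvd a - b \<Longrightarrow> a \<in> Sr \<longleftrightarrow> b \<in> Sr"
  using S_cong[of a b] S_cong[of "a + m" "b + m"] by (simp add: Sr_def)

lemma Sr_half: "s + m \<in> Sr \<longleftrightarrow> s \<in> Sr"
  using S_period[of s] by (auto simp: Sr_def add.assoc)

text \<open>The second component of the lifted two-fold automorphism is \<open>\<lambda>x. \<sigma> x + half (w x)\<close>.\<close>

definition two_fold :: "(int \<Rightarrow> int) \<Rightarrow> (int \<Rightarrow> bool) \<Rightarrow> bool" where
  "two_fold \<sigma> w \<longleftrightarrow> \<sigma> \<in> Per n \<and> (\<forall>x. n dvd \<sigma> (x + m) - \<sigma> x - m) \<and> (\<forall>x. w (x + m) = w x) \<and>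
     (\<forall>x y. y - x \<in> S \<longleftrightarrow> \<sigma> y - \<sigma> x + half (w y) \<in> S)"

lemma two_foldD:
  assumes "two_fold \<sigma> w"
  shows "\<sigma> \<in> Per n" "n dvd \<sigma> (x + m) - \<sigma> x - m" "w (x + m) = w x"
    "y - x \<in> S \<longleftrightarrow> \<sigma> y - \<sigma> x + half (w y) \<in> S"
  using assms by (auto simp: two_fold_def)

lemma two_fold_cong:
  assumes s: "two_fold \<sigma> w" and "n dvd a - b" shows "w a = w b"
proof -
  obtain k where k: "a = b + k * n" using assms(2) by (rule dvd_diff_imp_shift)
  have "w (z + n) = w z" for z
    using two_foldD(3)[OF s, of z] two_foldD(3)[OF s, of "z + m"] by (simp add: algebra_simps)
  then show ?thesis using periodic_int[of w n b k] k by simp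
qed

lemma two_fold_half:
  assumes "two_fold \<sigma> w"
  shows "n dvd \<sigma> (x + half b) - \<sigma> x - half b" "w (x + half b) = w x"
  using two_foldD[OF assms] by (auto simp: half_def)

lemma two_fold_trans: "two_fold (\<lambda>x. x + a) (\<lambda>_. False)"
  by (auto simp: two_fold_def Per_trans half_def)

lemma dvd_half_twice: "n dvd half b + half b"
  by (auto simp: half_def)

text \<open>The displacement \<open>half (v y)\<close> passes through \<open>\<sigma>\<close>
  unchanged modulo \<open>n\<close>, because \<open>\<sigma>\<close> commutes with the shift by
  \<open>m\<close> modulo \<open>n\<close> and \<open>w\<close> has period \<open>m\<close>. The two
  displacements then add modulo \<open>n\<close>.\<close>

lemma two_fold_comp:
  assumes s: "two_fold \<sigma> w" and t: "two_fold \<tau> v"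
  shows "two_fold (\<lambda>x. \<sigma> (\<tau> x)) (\<lambda>x. w (\<tau> x) \<noteq> v x)"
  unfolding two_fold_def
proof (intro conjI allI)
  note sP = two_foldD(1)[OF s] and tP = two_foldD(1)[OF t]
  show "(\<lambda>x. \<sigma> (\<tau> x)) \<in> Per n" using sP tP by (rule Per_comp)
  have st: "n dvd \<sigma> (\<tau> (x + m)) - \<sigma> (\<tau> x + m)" for x
    using Per_cong[OF sP, of "\<tau> (x + m)" "\<tau> x + m"] two_foldD(2)[OF t, of x] by (simp add: algebra_simps)
  fix x
  show "n dvd \<sigma> (\<tau> (x + m)) - \<sigma> (\<tau> x) - m"
    using dvd_add[OF st[of x] two_foldD(2)[OF s, of "\<tau> x"]] by (simp add: algebra_simps)
  show "(w (\<tau> (x + m)) \<noteq> v (x + m)) = (w (\<tau> x) \<noteq> v x)"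
    using two_fold_cong[OF s, of "\<tau> (x + m)" "\<tau> x + m"] two_foldD(2)[OF t, of x] two_foldD(3)[OF t, of x]
      two_foldD(3)[OF s, of "\<tau> x"] by (simp add: algebra_simps)
  fix y
  have "y - x \<in> S \<longleftrightarrow> (\<tau> y + half (v y)) - \<tau> x \<in> S"
    using two_foldD(4)[OF t, of y x] by (simp add: algebra_simps)
  also have "\<dots> \<longleftrightarrow> \<sigma> (\<tau> y + half (v y)) - \<sigma> (\<tau> x) + half (w (\<tau> y)) \<in> S"
    using two_foldD(4)[OF s, of "\<tau> y + half (v y)" "\<tau> x"] two_fold_half(2)[OF s] by simp
  also have "\<dots> \<longleftrightarrow> \<sigma> (\<tau> y) + half (v y) - \<sigma> (\<tau> x) + half (w (\<tau> y)) \<in> S"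
    by (rule S_cong) (use two_fold_half(1)[OF s, of "\<tau> y" "v y"] in \<open>simp add: algebra_simps\<close>)
  also have "\<dots> \<longleftrightarrow> \<sigma> (\<tau> y) - \<sigma> (\<tau> x) + half (w (\<tau> y) \<noteq> v y) \<in> S"
    by (rule S_cong) (auto simp: half_def)
  finally show "y - x \<in> S \<longleftrightarrow> \<sigma> (\<tau> y) - \<sigma> (\<tau> x) + half (w (\<tau> y) \<noteq> v y) \<in> S" .
qed

lemma two_fold_shift: "two_fold \<sigma> w \<Longrightarrow> two_fold (\<lambda>x. \<sigma> (x + a)) (\<lambda>x. w (x + a))"
  using two_fold_comp[OF _ two_fold_trans[of a]] by simp

text \<open>A displacement by 0 or \<open>m\<close> is its own inverse modulo \<open>n\<close>, so
  undoing \<open>\<sigma>\<close> needs the same displacement, read at the preimage.\<close>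

lemma two_fold_inv:
  assumes s: "two_fold \<sigma> w"
  shows "two_fold (finv \<sigma>) (\<lambda>x. w (finv \<sigma> x))"
  unfolding two_fold_def
proof (intro conjI allI)
  note sP = two_foldD(1)[OF s]
  have iP: "finv \<sigma> \<in> Per n" using sP by (rule Per_inv)
  then show "finv \<sigma> \<in> Per n" .
  fix x
  have "n dvd finv \<sigma> (\<sigma> (finv \<sigma> x + m)) - finv \<sigma> (\<sigma> (finv \<sigma> x) + m)"
    by (rule Per_cong[OF iP]) (use two_foldD(2)[OF s, of "finv \<sigma> x"] in \<open>simp add: algebra_simps\<close>)
  then have half: "n dvd finv \<sigma> x + m - finv \<sigma> (x + m)" using sP by simp
  then show "n dvd finv \<sigma> (x + m) - finv \<sigma> x - m"
    using dvd_minus_iff[of n "finv \<sigma> x + m - finv \<sigma> (x + m)"] by (simp add: algebra_simps)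
  show "w (finv \<sigma> (x + m)) = w (finv \<sigma> x)"
    using two_fold_cong[OF s half] two_foldD(3)[OF s, of "finv \<sigma> x"] by simp
  fix y
  let ?u = "finv \<sigma> x" and ?v = "finv \<sigma> y"
  have "finv \<sigma> y - finv \<sigma> x + half (w ?v) \<in> S \<longleftrightarrow> (?v + half (w ?v)) - ?u \<in> S"
    by (simp add: algebra_simps)
  also have "\<dots> \<longleftrightarrow> \<sigma> (?v + half (w ?v)) - x + half (w ?v) \<in> S"
    using two_foldD(4)[OF s, of "?v + half (w ?v)" ?u] two_fold_half(2)[OF s] sP by simp
  also have "\<dots> \<longleftrightarrow> y - x \<in> S"
    by (rule S_cong) (use dvd_add[OF two_fold_half(1)[OF s, of ?v "w ?v"] dvd_half_twice[of "w ?v"]] sP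
        in \<open>simp add: algebra_simps\<close>)
  finally show "y - x \<in> S \<longleftrightarrow> finv \<sigma> y - finv \<sigma> x + half (w ?v) \<in> S" by simp
qed

text \<open>The two-fold condition at \<open>y\<close> and at \<open>y + m\<close> transfers both
  membership conditions that define \<open>Sr\<close>; a displacement by \<open>m\<close> only
  exchanges the two. So \<open>\<sigma>\<close> acts as an automorphism of the reflective
  graph.\<close>

lemma two_fold_Sr:
  assumes s: "two_fold \<sigma> w"
  shows "y - x \<in> Sr \<longleftrightarrow> \<sigma> y - \<sigma> x \<in> Sr"
proof -
  have "y + m - x \<in> S \<longleftrightarrow> \<sigma> (y + m) - \<sigma> x + half (w y) \<in> S"
    using two_foldD(4)[OF s, of "y + m" x] two_foldD(3)[OF s, of y] by simp
  also have "\<dots> \<longleftrightarrow> \<sigma> y - \<sigma> x + m + half (w y) \<in> S"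
    by (rule S_cong) (use two_foldD(2)[OF s, of y] in \<open>simp add: algebra_simps\<close>)
  finally have "y - x \<in> Sr \<longleftrightarrow> \<sigma> y - \<sigma> x + half (w y) \<in> S \<and> \<sigma> y - \<sigma> x + half (w y) + m \<in> S"
    using two_foldD(4)[OF s, of y x] by (simp add: Sr_def algebra_simps)
  also have "\<dots> \<longleftrightarrow> \<sigma> y - \<sigma> x + half (w y) \<in> Sr" by (simp add: Sr_def)
  also have "\<dots> \<longleftrightarrow> \<sigma> y - \<sigma> x \<in> Sr" using Sr_half by (simp add: half_def)
  finally show ?thesis .
qed

section \<open>The subgroup of common periods of the cocycles\<close>

definition B :: "int set" where
  "B = {b. \<forall>\<sigma> w. two_fold \<sigma> w \<longrightarrow> w b = w 0}"

text \<open>Precomposing with a translation shifts the cocycle, so comparing with the base point 0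
  amounts to comparing any two points.\<close>

lemma B_diff_iff: "x - y \<in> B \<longleftrightarrow> (\<forall>\<sigma> w. two_fold \<sigma> w \<longrightarrow> w x = w y)"
proof
  assume b: "x - y \<in> B"
  show "\<forall>\<sigma> w. two_fold \<sigma> w \<longrightarrow> w x = w y"
  proof (intro allI impI)
    fix \<sigma> w assume "two_fold \<sigma> w"
    from two_fold_shift[OF this, of y] b have "w (x - y + y) = w (0 + y)"
      unfolding B_def by blast
    then show "w x = w y" by simp
  qed
next
  assume h: "\<forall>\<sigma> w. two_fold \<sigma> w \<longrightarrow> w x = w y"
  show "x - y \<in> B" unfolding B_def
  proof (intro CollectI allI impI)
    fix \<sigma> w assume "two_fold \<sigma> w"
    from h two_fold_shift[OF this, of "- y"] have "w (x + (- y)) = w (y + (- y))"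
      by blast
    then show "w (x - y) = w 0" by simp
  qed
qed

lemma B_half: "m \<in> B"
  using B_diff_iff[of m 0] two_foldD(3)[of _ _ 0] by auto

lemma B_psg: "period_subgroup n B"
proof -
  have "a - b \<in> B" if "a \<in> B" "b \<in> B" for a b
    using that B_diff_iff[of a b] by (auto simp: B_def)
  moreover have "0 \<in> B" by (simp add: B_def)
  \<comment> \<open>This element is \<open>n\<close>, written so that closure under differences
    applies.\<close>
  moreover have "m - (0 - m) \<in> B" using calculation B_half by blast
  ultimately show ?thesis by (simp add: period_subgroup_def)
qed

text \<open>By the composition rule, \<open>w (\<tau> x)\<close> is the exclusive or of two cocycles
  at \<open>x\<close>, the one of the composite and \<open>v\<close>; both are constant on cosets of
  \<open>B\<close>.\<close>

lemma two_fold_B: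
  assumes "two_fold \<tau> v" "x - y \<in> B" shows "\<tau> x - \<tau> y \<in> B"
  unfolding B_diff_iff
proof (intro allI impI)
  fix \<sigma> w assume "two_fold \<sigma> w"
  from two_fold_comp[OF this assms(1)] have "(w (\<tau> x) \<noteq> v x) = (w (\<tau> y) \<noteq> v y)"
    using assms(2) unfolding B_diff_iff by blast
  then show "w (\<tau> x) = w (\<tau> y)" using assms B_diff_iff by blast
qed

text \<open>The edge between 0 and \<open>s\<close> can be read from either end, with displacement
  \<open>half (w s)\<close> or \<open>half (w 0)\<close>. If these differ for some
  \<open>\<sigma>\<close>, the image edge is reflective, and \<open>\<sigma>\<close> preserves and
  reflects this.\<close>

lemma S_outside_B: "s \<in> S \<Longrightarrow> s \<notin> B \<Longrightarrow> s \<in> Sr"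
proof (rule ccontr)
  assume s: "s \<in> S" "s \<notin> B" "s \<notin> Sr"
  then obtain \<sigma> w where t: "two_fold \<sigma> w" and ne: "w s \<noteq> w 0" by (auto simp: B_def)
  have 1: "\<sigma> s - \<sigma> 0 + half (w s) \<in> S" using two_foldD(4)[OF t, of s 0] s(1) by simp
  have "\<sigma> 0 - \<sigma> s + half (w 0) \<in> S" using two_foldD(4)[OF t, of 0 s] s(1) S_sym by simp
  then have "\<sigma> s - \<sigma> 0 - half (w 0) \<in> S" using S_sym[of "\<sigma> s - \<sigma> 0 - half (w 0)"] by (simp add: algebra_simps)
  moreover have "n dvd \<sigma> s - \<sigma> 0 - half (w 0) - (\<sigma> s - \<sigma> 0 + half (w 0))"
    using dvd_half_twice dvd_minus_iff[of n "half (w 0) + half (w 0)"] by (simp add: algebra_simps)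
  ultimately have 2: "\<sigma> s - \<sigma> 0 + half (w 0) \<in> S" using S_cong by blast
  have "\<sigma> s - \<sigma> 0 + half (w s) + m \<in> S"
  proof -
    have "n dvd \<sigma> s - \<sigma> 0 + half (w s) + m - (\<sigma> s - \<sigma> 0 + half (w 0))"
      using ne by (auto simp: half_def)
    then show ?thesis using 2 S_cong by blast
  qed
  with 1 have "\<sigma> s - \<sigma> 0 + half (w s) \<in> Sr" by (simp add: Sr_def)
  then have "\<sigma> s - \<sigma> 0 \<in> Sr" using Sr_half by (simp add: half_def split: if_splits)
  then show False using two_fold_Sr[OF t, of s 0] s(3) by simp
qed

text \<open>Lifted automorphisms of the reflective graph fixing every coset of \<open>H\<close>.\<close>

definition CF :: "int set \<Rightarrow> (int \<Rightarrow> int) set" where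
  "CF H = {\<sigma> \<in> Per n. (\<forall>x. \<sigma> x - x \<in> H) \<and> (\<forall>x y. y - x \<in> Sr \<longleftrightarrow> \<sigma> y - \<sigma> x \<in> Sr)}"

lemma CFD:
  assumes "\<sigma> \<in> CF H"
  shows "\<sigma> \<in> Per n" "\<sigma> x - x \<in> H" "y - x \<in> Sr \<longleftrightarrow> \<sigma> y - \<sigma> x \<in> Sr"
  using assms by (auto simp: CF_def)

lemma CF_mono: "H \<subseteq> H' \<Longrightarrow> CF H \<subseteq> CF H'"
  by (auto simp: CF_def)

lemma CF_comp:
  assumes H: "period_subgroup n H" and "\<sigma> \<in> CF H" "\<tau> \<in> CF H"
  shows "(\<lambda>x. \<sigma> (\<tau> x)) \<in> CF H"
proof -
  have "\<sigma> (\<tau> x) - x \<in> H" for x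
    using psg_trans[OF H CFD(2)[OF assms(2)] CFD(2)[OF assms(3)]] .
  moreover have "y - x \<in> Sr \<longleftrightarrow> \<sigma> (\<tau> y) - \<sigma> (\<tau> x) \<in> Sr" for x y
    using CFD(3)[OF assms(3), of y x] CFD(3)[OF assms(2), of "\<tau> y" "\<tau> x"] by simp
  ultimately show ?thesis using Per_comp[OF CFD(1)[OF assms(2)] CFD(1)[OF assms(3)]] by (simp add: CF_def)
qed

lemma CF_inv:
  assumes H: "period_subgroup n H" and s: "\<sigma> \<in> CF H"
  shows "finv \<sigma> \<in> CF H"
proof -
  have "finv \<sigma> x - x \<in> H" for x
    using CFD(2)[OF s, of "finv \<sigma> x"] CFD(1)[OF s] psg_flip[OF H] by simp
  moreover have "y - x \<in> Sr \<longleftrightarrow> finv \<sigma> y - finv \<sigma> x \<in> Sr" for x y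
    using CFD(3)[OF s, of "finv \<sigma> y" "finv \<sigma> x"] CFD(1)[OF s] by simp
  ultimately show ?thesis using CFD(1)[OF s] by (simp add: CF_def Per_inv)
qed

lemma CF_trans: "a \<in> H \<Longrightarrow> (\<lambda>x. x + a) \<in> CF H"
  by (simp add: CF_def Per_trans)

lemma CF_conj:
  assumes s: "two_fold \<sigma> w" and pres: "\<And>x y. x - y \<in> H \<Longrightarrow> \<sigma> x - \<sigma> y \<in> H" and t: "\<mu> \<in> CF H"
  shows "(\<lambda>x. \<sigma> (\<mu> (finv \<sigma> x))) \<in> CF H"
proof -
  note sP = two_foldD(1)[OF s] and tP = CFD(1)[OF t]
  have "\<sigma> (\<mu> (finv \<sigma> x)) - \<sigma> (finv \<sigma> x) \<in> H" for x using CFD(2)[OF t] by (rule pres)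
  moreover have "y - x \<in> Sr \<longleftrightarrow> \<sigma> (\<mu> (finv \<sigma> y)) - \<sigma> (\<mu> (finv \<sigma> x)) \<in> Sr" for x y
    using two_fold_Sr[OF two_fold_inv[OF s], of y x] CFD(3)[OF t, of "finv \<sigma> y" "finv \<sigma> x"] two_fold_Sr[OF s]
    by simp
  ultimately show ?thesis using Per_comp[OF sP Per_comp[OF tP Per_inv[OF sP]]] sP by (simp add: CF_def)
qed

lemma CF_trans_conj:
  assumes "\<mu> \<in> CF H" shows "(\<lambda>x. \<mu> (x + a) - a) \<in> CF H"
proof -
  have "(\<lambda>x. \<mu> (x + a) + (- a)) \<in> Per n"
    by (intro Per_comp[OF Per_trans] Per_comp[OF CFD(1)[OF assms] Per_trans])
  moreover have "\<mu> (x + a) - a - x \<in> H" for x using CFD(2)[OF assms, of "x + a"] by (simp add: algebra_simps)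
  moreover have "y - x \<in> Sr \<longleftrightarrow> \<mu> (y + a) - \<mu> (x + a) \<in> Sr" for x y
    using CFD(3)[OF assms, of "y + a" "x + a"] by simp
  ultimately show ?thesis by (simp add: CF_def)
qed

text \<open>Here \<open>f x\<close> is the representative chosen for the coset of \<open>x\<close>.\<close>

definition replaces :: "int set \<Rightarrow> (int \<Rightarrow> int) \<Rightarrow> bool" where
  "replaces H f \<longleftrightarrow> (\<forall>x. f x - x \<in> H) \<and> (\<forall>x y. x - y \<in> H \<longrightarrow> f x = f y) \<and> (\<forall>x\<in>H. f x = 0) \<and>
     (\<forall>\<sigma>\<in>CF H. (\<lambda>x. \<sigma> (x - f x) + f x) \<in> CF H)"

lemma replacesD:
  assumes "replaces H f"
  shows "f x - x \<in> H" "x - y \<in> H \<Longrightarrow> f x = f y" "x \<in> H \<Longrightarrow> f x = 0"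
    "\<sigma> \<in> CF H \<Longrightarrow> (\<lambda>x. \<sigma> (x - f x) + f x) \<in> CF H"
  using assms by (auto simp: replaces_def)

text \<open>The map \<open>\<phi>\<close> copies the action of \<open>\<sigma>\<close> on
  \<open>H\<close> to every coset of \<open>H\<close>. Inside a coset, \<open>tw\<close> applies
  after subtracting the representative. Between cosets, \<open>S\<close> agrees with
  \<open>Sr\<close>, which does not notice the addition of \<open>m\<close>.\<close>

lemma iso_if_twisted_on_subgroup:
  assumes H: "period_subgroup n H" "B \<subseteq> H" and f: "replaces H f" and s: "\<sigma> \<in> CF H"
    and tw: "\<And>x y. x \<in> H \<Longrightarrow> y \<in> H \<Longrightarrow> y - x \<in> S \<longleftrightarrow> \<sigma> y - \<sigma> x + m \<in> S"
  shows "\<exists>\<phi>\<in>Per n. \<forall>x y. y - x \<in> S \<longleftrightarrow> \<phi> y - \<phi> x + m \<in> S"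
proof -
  define \<phi> where "\<phi> x = \<sigma> (x - f x) + f x" for x
  have phi: "\<phi> \<in> CF H" unfolding \<phi>_def using replacesD(4)[OF f s] .
  have "y - x \<in> S \<longleftrightarrow> \<phi> y - \<phi> x + m \<in> S" for x y
  proof (cases "y - x \<in> H")
    case True
    then have "f y = f x" by (rule replacesD(2)[OF f])
    moreover have "x - f x \<in> H" "y - f y \<in> H" using replacesD(1)[OF f] psg_flip[OF H(1)] by blast+
    ultimately show ?thesis using tw[of "x - f x" "y - f x"] by (simp add: \<phi>_def)
  next
    case False
    \<comment> \<open>Since \<open>m\<close> lies in \<open>B\<close> and so in \<open>H\<close>,
      the twist cannot bring the difference back into \<open>H\<close>.\<close>
    have "(\<phi> y - \<phi> x + m) - (y - x) = (\<phi> y - y) - (\<phi> x - x) + m" by simp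
    also have "\<dots> \<in> H" using CFD(2)[OF phi] B_half H psg_add psg_diff by (meson subsetD)
    finally have out: "\<phi> y - \<phi> x + m \<notin> H" using False psg_cong[OF H(1)] by blast
    have S_eq: "s \<in> S \<longleftrightarrow> s \<in> Sr" if "s \<notin> H" for s using S_outside_B that H(2) by (auto simp: Sr_def)
    show ?thesis using S_eq[OF False] S_eq[OF out] CFD(3)[OF phi, of y x] Sr_half by simp
  qed
  then show ?thesis using CFD(1)[OF phi] by blast
qed

end

section \<open>Automorphisms of the reflective graph fixing cosets\<close>

lemma bij_glue:
  assumes p: "bij p" "\<And>z. p z \<in> U \<longleftrightarrow> z \<in> U" and q: "bij q" "\<And>z. q z \<in> U \<longleftrightarrow> z \<in> U"
  shows "bij (\<lambda>z. if z \<in> U then p z else q z)"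
proof (rule bijI)
  show "inj (\<lambda>z. if z \<in> U then p z else q z)"
  proof (rule injI)
    fix y z assume eq: "(if y \<in> U then p y else q y) = (if z \<in> U then p z else q z)"
    then have "y \<in> U \<longleftrightarrow> z \<in> U" using p(2)[of y] p(2)[of z] q(2)[of y] q(2)[of z] by metis
    then show "y = z" using eq injD[OF bij_is_inj[OF p(1)], of y z] injD[OF bij_is_inj[OF q(1)], of y z]
      by (simp split: if_splits)
  qed
  show "surj (\<lambda>z. if z \<in> U then p z else q z)"
  proof (rule surjI)
    fix z
    let ?u = "if z \<in> U then finv p z else finv q z"
    have "p (finv p z) = z" "q (finv q z) = z" using p(1) q(1) by (simp_all add: bij_is_surj surj_f_inv_f)
    then show "(if ?u \<in> U then p ?u else q ?u) = z" using p(2)[of "finv p z"] q(2)[of "finv q z"] by auto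
  qed
qed

context circulant
begin

text \<open>Two-fold automorphisms and elements of \<open>CF B\<close> share these properties, so
  the orbit arguments below serve both.\<close>

definition normalizing :: "(int \<Rightarrow> int) \<Rightarrow> bool" where
  "normalizing \<sigma> \<longleftrightarrow> \<sigma> \<in> Per n \<and> (\<forall>x y. x - y \<in> B \<longleftrightarrow> \<sigma> x - \<sigma> y \<in> B) \<and>
     (\<forall>\<mu>\<in>CF B. (\<lambda>x. \<sigma> (\<mu> (finv \<sigma> x))) \<in> CF B) \<and> (\<forall>\<mu>\<in>CF B. (\<lambda>x. finv \<sigma> (\<mu> (\<sigma> x))) \<in> CF B)"

lemma normalizingD:
  assumes "normalizing \<sigma>"
  shows "\<sigma> \<in> Per n" "x - y \<in> B \<longleftrightarrow> \<sigma> x - \<sigma> y \<in> B"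
    "\<mu> \<in> CF B \<Longrightarrow> (\<lambda>x. \<sigma> (\<mu> (finv \<sigma> x))) \<in> CF B" "\<mu> \<in> CF B \<Longrightarrow> (\<lambda>x. finv \<sigma> (\<mu> (\<sigma> x))) \<in> CF B"
  using assms by (auto simp: normalizing_def)

lemma inv_inv_Per [simp]: "\<sigma> \<in> Per k \<Longrightarrow> finv (finv \<sigma>) = \<sigma>"
  by (simp add: Per_def inv_inv_eq)

lemma normalizing_inv:
  assumes "normalizing \<sigma>" shows "normalizing (finv \<sigma>)"
proof -
  note D = normalizingD[OF assms]
  have "x - y \<in> B \<longleftrightarrow> finv \<sigma> x - finv \<sigma> y \<in> B" for x y
    using D(2)[of "finv \<sigma> x" "finv \<sigma> y"] D(1) by simp
  then show ?thesis using D(1,3,4) by (simp add: normalizing_def Per_inv)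
qed

lemma normalizing_two_fold:
  assumes s: "two_fold \<sigma> w" shows "normalizing \<sigma>"
proof -
  note i = two_fold_inv[OF s] and sP = two_foldD(1)[OF s]
  have "x - y \<in> B \<longleftrightarrow> \<sigma> x - \<sigma> y \<in> B" for x y
    using two_fold_B[OF s, of x y] two_fold_B[OF i, of "\<sigma> x" "\<sigma> y"] sP by auto
  moreover have "(\<lambda>x. finv \<sigma> (\<mu> (\<sigma> x))) \<in> CF B" if "\<mu> \<in> CF B" for \<mu>
    using CF_conj[OF i two_fold_B[OF i] that] sP by simp
  moreover have "(\<lambda>x. \<sigma> (\<mu> (finv \<sigma> x))) \<in> CF B" if "\<mu> \<in> CF B" for \<mu>
    using CF_conj[OF s two_fold_B[OF s] that] .
  ultimately show ?thesis using sP by (simp add: normalizing_def)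
qed

lemma normalizing_CF:
  assumes s: "\<sigma> \<in> CF B" shows "normalizing \<sigma>"
proof -
  note i = CF_inv[OF B_psg s]
  have "x - y \<in> B \<longleftrightarrow> \<sigma> x - \<sigma> y \<in> B" for x y
  proof -
    have "(x - y) - (\<sigma> x - \<sigma> y) = (\<sigma> y - y) - (\<sigma> x - x)" by simp
    also have "\<dots> \<in> B" using CFD(2)[OF s] psg_diff[OF B_psg] by blast
    finally show ?thesis by (rule psg_cong[OF B_psg])
  qed
  then show ?thesis using s i CFD(1)[OF s] 
    by (simp add: normalizing_def CF_comp[OF B_psg s CF_comp[OF B_psg _ i]] CF_comp[OF B_psg i CF_comp[OF B_psg _ s]])
qed

text \<open>For \<open>L = Nz\<close> this is the pointwise stabilizer of the coset of
  \<open>x\<close>; a larger \<open>L\<close> only asks for a trivial action modulo \<open>L\<close>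
  there.\<close>

definition K :: "int set \<Rightarrow> int \<Rightarrow> (int \<Rightarrow> int) set" where
  "K L x = {\<mu> \<in> CF B. \<forall>z. z - x \<in> B \<longrightarrow> \<mu> z - z \<in> L}"

abbreviation Nz :: "int set" where "Nz \<equiv> {a. n dvd a}"

text \<open>
  The orbit of \<open>y\<close> under the pointwise stabilizer of the coset of \<open>x\<close>, translated by \<open>- y\<close> so as
  to be a subgroup of \<open>B\<close>.
\<close>

definition orb :: "int \<Rightarrow> int \<Rightarrow> int set" where
  "orb x y = {b. \<exists>\<mu>\<in>K Nz x. n dvd \<mu> y - y - b}"

lemma orbI: "\<mu> \<in> K Nz x \<Longrightarrow> n dvd \<mu> y - y - b \<Longrightarrow> b \<in> orb x y"
  by (auto simp: orb_def)

lemma K_CF: "\<mu> \<in> K L x \<Longrightarrow> \<mu> \<in> CF B"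
  and KD: "\<mu> \<in> K L x \<Longrightarrow> z - x \<in> B \<Longrightarrow> \<mu> z - z \<in> L"
  by (auto simp: K_def)

lemma K_mono: "L \<subseteq> L' \<Longrightarrow> K L x \<subseteq> K L' x"
  by (auto simp: K_def)

lemma K_coset: assumes "x - y \<in> B" shows "K L x = K L y"
proof -
  have "z - x \<in> B \<longleftrightarrow> z - y \<in> B" for z
    using psg_add_right[OF B_psg assms, of "z - x"] by simp
  then show ?thesis by (simp add: K_def)
qed

lemma K_comp:
  assumes L: "period_subgroup n L" and m: "\<mu> \<in> K L x" "\<nu> \<in> K L x"
  shows "(\<lambda>z. \<mu> (\<nu> z)) \<in> K L x"
proof -
  have "\<mu> (\<nu> z) - z \<in> L" if "z - x \<in> B" for z
  proof -
    have "\<nu> z - x \<in> B" using psg_trans[OF B_psg CFD(2)[OF K_CF[OF m(2)]] that] .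
    then show ?thesis using psg_trans[OF L KD[OF m(1)] KD[OF m(2) that]] by blast
  qed
  then show ?thesis using CF_comp[OF B_psg K_CF[OF m(1)] K_CF[OF m(2)]] by (simp add: K_def)
qed

lemma K_inv:
  assumes L: "period_subgroup n L" and m: "\<mu> \<in> K L x"
  shows "finv \<mu> \<in> K L x"
proof -
  note i = CF_inv[OF B_psg K_CF[OF m]]
  have "finv \<mu> z - z \<in> L" if "z - x \<in> B" for z
  proof -
    have "finv \<mu> z - x \<in> B" using psg_trans[OF B_psg CFD(2)[OF i] that] .
    then have "\<mu> (finv \<mu> z) - finv \<mu> z \<in> L" by (rule KD[OF m])
    then show ?thesis using psg_flip[OF L] CFD(1)[OF K_CF[OF m]] by simp
  qed
  then show ?thesis using i by (simp add: K_def)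
qed

lemma K_conj:
  assumes s: "normalizing \<sigma>" and L: "\<And>a b. a - b \<in> L \<Longrightarrow> \<sigma> a - \<sigma> b \<in> L" and m: "\<mu> \<in> K L x"
  shows "(\<lambda>z. \<sigma> (\<mu> (finv \<sigma> z))) \<in> K L (\<sigma> x)"
proof -
  note sP = normalizingD(1)[OF s]
  have "\<sigma> (\<mu> (finv \<sigma> z)) - z \<in> L" if "z - \<sigma> x \<in> B" for z
  proof -
    have "finv \<sigma> z - x \<in> B" using that normalizingD(2)[OF s, of "finv \<sigma> z" x] sP by simp
    then have "\<sigma> (\<mu> (finv \<sigma> z)) - \<sigma> (finv \<sigma> z) \<in> L" using KD[OF m] L by blast
    then show ?thesis using sP by simp
  qed
  then show ?thesis using normalizingD(3)[OF s K_CF[OF m]] by (simp add: K_def)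
qed

lemma K_shift:
  assumes m: "\<mu> \<in> K L x" shows "(\<lambda>z. \<mu> (z + a) - a) \<in> K L (x - a)"
proof -
  have "\<mu> (z + a) - a - z \<in> L" if "z - (x - a) \<in> B" for z
    using KD[OF m, of "z + a"] that by (simp add: algebra_simps)
  then show ?thesis using CF_trans_conj[OF K_CF[OF m]] by (simp add: K_def)
qed

section \<open>Orbits of pointwise stabilizers of cosets\<close>

lemma orb_subset_B: "orb x y \<subseteq> B"
proof
  fix b assume "b \<in> orb x y"
  then obtain \<mu> where m: "\<mu> \<in> K Nz x" and "n dvd \<mu> y - y - b" by (auto simp: orb_def)
  then have "\<mu> y - y - b \<in> B" using psg_dvd[OF B_psg] by blast
  then show "b \<in> B" using CFD(2)[OF K_CF[OF m], of y] psg_cong[OF B_psg] by blast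
qed

lemma orb_shift_sub: "orb x y \<subseteq> orb (x - a) (y - a)"
proof
  fix b assume "b \<in> orb x y"
  then obtain \<mu> where m: "\<mu> \<in> K Nz x" and "n dvd \<mu> y - y - b" by (auto simp: orb_def)
  then show "b \<in> orb (x - a) (y - a)" by (intro orbI[OF K_shift[OF m]]) simp
qed

lemma orb_shift: "orb (x + a) (y + a) = orb x y"
  using orb_shift_sub[of "x + a" "y + a" a] orb_shift_sub[of x y "- a"] by simp

lemma orb_coset_left: "x - x' \<in> B \<Longrightarrow> orb x y = orb x' y"
  unfolding orb_def using K_coset by presburger

text \<open>Translation invariance trades a move of \<open>y\<close> inside its coset of
  \<open>B\<close> for a move of \<open>x\<close> inside its own coset, which leaves the stabilizer
  unchanged.\<close>

lemma orb_coset: assumes "y - y' \<in> B" shows "orb x y = orb x y'"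
proof -
  have "(x + (y' - y)) - x \<in> B" using assms psg_flip[OF B_psg] by simp
  then have "orb x y' = orb (x + (y' - y)) y'" using orb_coset_left by blast
  also have "\<dots> = orb x y" using orb_shift[of x "y' - y" y] by simp
  finally show ?thesis by simp
qed

lemma orb_psg: "period_subgroup n (orb x y)"
proof -
  have id: "(\<lambda>z. z) \<in> K Nz x" using CF_trans[OF psg_zero[OF B_psg]] by (simp add: K_def)
  then have "0 \<in> orb x y" "n \<in> orb x y" unfolding orb_def by force+
  moreover have "b - c \<in> orb x y" if b: "b \<in> orb x y" and c: "c \<in> orb x y" for b c
  proof -
    \<comment> \<open>The orbits may be based at \<open>y - c\<close> instead of \<open>y\<close>.
      There \<open>\<nu>\<close> carries \<open>y - c\<close> to \<open>y\<close>, so its inverse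
      followed by \<open>\<mu>\<close> carries \<open>y\<close> to
      \<open>y + (b - c)\<close>.\<close>
    have "c \<in> B" using c orb_subset_B by blast
    then have "orb x (y - c) = orb x y"
      using psg_uminus[OF B_psg] by (intro orb_coset) simp
    then obtain \<mu> \<nu> where m: "\<mu> \<in> K Nz x" "n dvd \<mu> (y - c) - (y - c) - b"
      and v: "\<nu> \<in> K Nz x" "n dvd \<nu> (y - c) - (y - c) - c"
      using b c unfolding orb_def by blast
    note vP = CFD(1)[OF K_CF[OF v(1)]]
    have "n dvd finv \<nu> (\<nu> (y - c)) - finv \<nu> y"
      by (rule Per_cong[OF Per_inv[OF vP]]) (use v(2) in simp)
    then have "n dvd (y - c) - finv \<nu> y" using vP by simp
    then have "n dvd \<mu> (y - c) - \<mu> (finv \<nu> y)" by (rule Per_cong[OF CFD(1)[OF K_CF[OF m(1)]]])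
    from dvd_diff[OF m(2) this] have "n dvd \<mu> (finv \<nu> y) - y - (b - c)" by (simp add: algebra_simps)
    then show ?thesis
      by (rule orbI[OF K_comp[OF psg_multiples m(1) K_inv[OF psg_multiples v(1)]]])
  qed
  ultimately show ?thesis by (simp add: period_subgroup_def)
qed

lemma orb_normalizing_sub:
  assumes s: "normalizing \<sigma>" and b: "b \<in> orb x y"
  shows "\<sigma> (y + b) - \<sigma> y \<in> orb (\<sigma> x) (\<sigma> y)"
proof -
  note sP = normalizingD(1)[OF s]
  obtain \<mu> where m: "\<mu> \<in> K Nz x" and d: "n dvd \<mu> y - y - b" using b by (auto simp: orb_def)
  have "n dvd \<sigma> (\<mu> y) - \<sigma> (y + b)"
    by (rule Per_cong[OF sP]) (use d in \<open>simp add: algebra_simps\<close>)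
  then have "n dvd \<sigma> (\<mu> (finv \<sigma> (\<sigma> y))) - \<sigma> y - (\<sigma> (y + b) - \<sigma> y)" using sP by simp
  moreover have "(\<lambda>z. \<sigma> (\<mu> (finv \<sigma> z))) \<in> K Nz (\<sigma> x)"
    by (rule K_conj[OF s _ m]) (use Per_cong[OF sP] in auto)
  ultimately show ?thesis using orbI[where \<mu> = "\<lambda>z. \<sigma> (\<mu> (finv \<sigma> z))"] by blast
qed

text \<open>The map \<open>?h\<close> is the action of \<open>\<sigma>\<close> on the orbit of
  \<open>y\<close>, seen relative to base points. It is not known to be a homomorphism, so only
  cardinalities are compared.\<close>

lemma card_orb_normalizing_le:
  assumes s: "normalizing \<sigma>"
  shows "card (orb x y \<inter> {0..<n}) \<le> card (orb (\<sigma> x) (\<sigma> y) \<inter> {0..<n})"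
proof (rule card_inj_on_le)
  let ?h = "\<lambda>b. (\<sigma> (y + b) - \<sigma> y) mod n"
  note sP = normalizingD(1)[OF s]
  show "inj_on ?h (orb x y \<inter> {0..<n})"
  proof (rule inj_onI)
    fix b c assume bc: "b \<in> orb x y \<inter> {0..<n}" "c \<in> orb x y \<inter> {0..<n}" and "?h b = ?h c"
    then have "n dvd \<sigma> (y + b) - \<sigma> (y + c)" by (simp add: mod_eq_dvd_iff)
    from Per_cong[OF Per_inv[OF sP] this] have "n dvd b - c" using sP by simp
    then have "b mod n = c mod n" by (simp add: mod_eq_dvd_iff)
    then show "b = c" using bc by simp
  qed
  show "?h ` (orb x y \<inter> {0..<n}) \<subseteq> orb (\<sigma> x) (\<sigma> y) \<inter> {0..<n}"
  proof
    fix c assume "c \<in> ?h ` (orb x y \<inter> {0..<n})"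
    then obtain b where b: "b \<in> orb x y" and c: "c = ?h b" by auto
    have "\<sigma> (y + b) - \<sigma> y - c \<in> orb (\<sigma> x) (\<sigma> y)" unfolding c
      by (rule psg_dvd[OF orb_psg]) (simp add: minus_mod_eq_mult_div)
    then have "c \<in> orb (\<sigma> x) (\<sigma> y)"
      using orb_normalizing_sub[OF s b] psg_cong[OF orb_psg] by blast
    then show "c \<in> orb (\<sigma> x) (\<sigma> y) \<inter> {0..<n}" using m_pos c by simp
  qed
qed simp

text \<open>The inequalities for \<open>\<sigma>\<close> and its inverse give equal orders, and the
  order determines a subgroup of a cyclic group.\<close>

lemma orb_normalizing:
  assumes s: "normalizing \<sigma>" shows "orb (\<sigma> x) (\<sigma> y) = orb x y"
proof (rule psg_eq_if_card_eq[OF _ orb_psg orb_psg])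
  show "card (orb (\<sigma> x) (\<sigma> y) \<inter> {0..<n}) = card (orb x y \<inter> {0..<n})"
    using card_orb_normalizing_le[OF s, of x y]
      card_orb_normalizing_le[OF normalizing_inv[OF s], of "\<sigma> x" "\<sigma> y"] normalizingD(1)[OF s]
    by simp
qed (use m_pos in simp)

text \<open>By translation invariance the subgroup \<open>orb x y\<close> is also an orbit based at
  \<open>b\<close>, so its cosets are respected everywhere.\<close>

lemma orb_block:
  assumes s: "normalizing \<sigma>" and ab: "a - b \<in> orb x y" shows "\<sigma> a - \<sigma> b \<in> orb x y"
proof -
  have eq: "orb (x + (b - y)) b = orb x y" using orb_shift[of x "b - y" y] by simp
  have "\<sigma> (b + (a - b)) - \<sigma> b \<in> orb (\<sigma> (x + (b - y))) (\<sigma> b)"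
    by (rule orb_normalizing_sub[OF s]) (use ab eq in simp)
  then show ?thesis unfolding orb_normalizing[OF s] eq by simp
qed

text \<open>Conjugation by the translation by \<open>c\<close> moves the action of
  \<open>\<mu>\<close> on the coset of \<open>c\<close> to \<open>B\<close>, from where the
  replacement property spreads it to all cosets.\<close>

lemma diagonal_CF:
  assumes f: "replaces B f" and m: "\<mu> \<in> CF B"
  shows "(\<lambda>z. \<mu> (z - f z + c) - c + f z) \<in> CF B"
  using replacesD(4)[OF f CF_trans_conj[OF m, of c]] by simp

text \<open>
  The map \<open>\<nu>\<close> below copies the action of \<open>\<mu>\<close> on the coset of \<open>x\<close> to all cosets. It agrees with \<open>\<mu>\<close>
  on the coset of \<open>x\<close>, so \<open>\<nu>\<inverse> \<mu>\<close> moves the points of the coset of \<open>y\<close> by elements of \<open>orb x y\<close>.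
\<close>

lemma K_propagates:
  assumes f: "replaces B f" and L: "period_subgroup n L" "orb x y \<subseteq> L" and m: "\<mu> \<in> K L x"
  shows "\<mu> \<in> K L y"
proof -
  define \<nu> where "\<nu> z = \<mu> (z - f z + f x) - f x + f z" for z
  note mC = K_CF[OF m]
  have vC: "\<nu> \<in> CF B" unfolding \<nu>_def by (rule diagonal_CF[OF f mC])
  note vP = CFD(1)[OF vC]
  have "\<nu> z = \<mu> z" if "z - x \<in> B" for z using replacesD(2)[OF f that] by (simp add: \<nu>_def)
  then have "finv \<nu> (\<mu> z) = z" if "z - x \<in> B" for z using that Per_inv_left[OF vP, of z] by simp
  then have k: "(\<lambda>z. finv \<nu> (\<mu> z)) \<in> K Nz x"
    using CF_comp[OF B_psg CF_inv[OF B_psg vC] mC] by (simp add: K_def)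
  have "\<mu> z - z \<in> L" if z: "z - y \<in> B" for z
  proof -
    define l where "l = finv \<nu> (\<mu> z) - z"
    define u where "u = z + l - f (z + l) + f x"
    have "n dvd finv \<nu> (\<mu> z) - z - l" by (simp add: l_def)
    then have "l \<in> orb x z" by (rule orbI[OF k])
    then have l: "l \<in> L" using orb_coset[OF z] L(2) by auto
    \<comment> \<open>The displacement of \<open>z\<close> is \<open>l\<close> plus the displacement
      under \<open>\<mu>\<close> of a point \<open>u\<close> in the coset of \<open>x\<close>; both
      lie in \<open>L\<close>.\<close>
    have "\<mu> z = \<nu> (z + l)" using vP by (simp add: l_def)
    also have "\<dots> = \<mu> u - f x + f (z + l)" by (simp add: \<nu>_def u_def)
    finally have eq: "\<mu> z - z = (\<mu> u - u) + l" by (simp add: u_def)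
    have "u - x = (f x - x) - (f (z + l) - (z + l))" by (simp add: u_def)
    also have "\<dots> \<in> B" using replacesD(1)[OF f] psg_diff[OF B_psg] by blast
    finally show ?thesis unfolding eq using psg_add[OF L(1) KD[OF m] l] by blast
  qed
  then show ?thesis using mC by (simp add: K_def)
qed

text \<open>Let \<open>\<nu>\<close> copy the action of \<open>\<kappa>\<close> on the coset of
  \<open>x\<close> to all cosets. Then \<open>\<nu>\<close> followed by the inverse of
  \<open>\<kappa>\<close> is trivial on the coset of \<open>x\<close>, while on the coset of
  \<open>y\<close>, where \<open>\<kappa>\<close> is trivial, it acts as that copy.\<close>

lemma orb_sym_sub:
  assumes f: "replaces B f" shows "orb y x \<subseteq> orb x y"
proof
  fix b assume b: "b \<in> orb y x"
  then obtain \<kappa> where k: "\<kappa> \<in> K Nz y" "n dvd \<kappa> x - x - b" by (auto simp: orb_def)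
  define \<nu> where "\<nu> z = \<kappa> (z - f z + f x) - f x + f z" for z
  \<comment> \<open>The point of the coset of \<open>y\<close> whose position relative to the
    representative is that of \<open>x\<close> in its own coset.\<close>
  define z where "z = x - f x + f y"
  note kC = K_CF[OF k(1)]
  note kP = CFD(1)[OF kC]
  have vC: "\<nu> \<in> CF B" unfolding \<nu>_def by (rule diagonal_CF[OF f kC])
  have "\<nu> z = \<kappa> z" if "z - x \<in> B" for z using replacesD(2)[OF f that] by (simp add: \<nu>_def)
  then have "finv \<kappa> (\<nu> z) = z" if "z - x \<in> B" for z using that kP by simp
  then have r: "(\<lambda>z. finv \<kappa> (\<nu> z)) \<in> K Nz x"
    using CF_comp[OF B_psg CF_inv[OF B_psg kC] vC] by (simp add: K_def)
  have "z - y = (f y - y) - (f x - x)" by (simp add: z_def)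
  also have "\<dots> \<in> B" using replacesD(1)[OF f] psg_diff[OF B_psg] by blast
  finally have zy: "z - y \<in> B" .
  have "\<nu> z = \<kappa> x - f x + f y" using replacesD(2)[OF f zy] by (simp add: \<nu>_def z_def)
  then have "n dvd \<nu> z - (z + b)" using k(2) by (simp add: z_def algebra_simps)
  from Per_cong[OF Per_inv[OF kP] this] have 1: "n dvd finv \<kappa> (\<nu> z) - finv \<kappa> (z + b)" .
  have "b \<in> B" using b orb_subset_B by blast
  then have "(z + b) - y \<in> B" using psg_add[OF B_psg zy] by (simp add: algebra_simps)
  from KD[OF K_inv[OF psg_multiples k(1)] this] have 2: "n dvd finv \<kappa> (z + b) - (z + b)" by simp
  have "n dvd finv \<kappa> (\<nu> z) - z - b" using dvd_add[OF 1 2] by (simp add: algebra_simps)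
  then have "b \<in> orb x z" by (rule orbI[OF r])
  then show "b \<in> orb x y" using orb_coset[OF zy] by simp
qed

lemma orb_sym: "replaces B f \<Longrightarrow> orb x y = orb y x"
  using orb_sym_sub by blast

end

text \<open>The assumption \<open>minimal\<close> expresses minimality of the block system by
  invariant equivalence relations: none lies strictly between congruence modulo \<open>B\<close> and
  congruence modulo \<open>Bt\<close>.\<close>

locale replacement = circulant +
  fixes Bt :: "int set" and f g :: "int \<Rightarrow> int"
  assumes Bt_psg: "period_subgroup n Bt"
    and B_sub: "B \<subset> Bt"
    and Bt_block: "two_fold \<sigma> w \<Longrightarrow> x - y \<in> Bt \<Longrightarrow> \<sigma> x - \<sigma> y \<in> Bt"
    and minimal: "\<lbrakk>equivp E; \<And>x y. x - y \<in> B \<Longrightarrow> E x y; \<And>x y. E x y \<Longrightarrow> x - y \<in> Bt;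
      \<And>\<sigma> w x y. two_fold \<sigma> w \<Longrightarrow> E x y \<Longrightarrow> E (\<sigma> x) (\<sigma> y); E x y; x - y \<notin> B; x' - y' \<in> Bt\<rbrakk> \<Longrightarrow> E x' y'"
    and f: "replaces B f"
    and g: "replaces Bt g"
begin

section \<open>Uniform orbits inside a coset of the larger subgroup\<close>

lemma CF_B_Bt: "\<mu> \<in> CF B \<Longrightarrow> \<mu> \<in> CF Bt"
  using CF_mono[of B Bt] B_sub by blast

text \<open>
  Having the same stabilizer \<open>K L\<close> is an invariant equivalence relation on points in a common
  coset of \<open>Bt\<close>. For \<open>L = orb x0 y0\<close> it is coarser than \<open>B\<close>, hence it is everything by minimality.
\<close>

lemma ex_common_orb:
  "\<exists>L. period_subgroup n L \<and> L \<subseteq> B \<and> (\<forall>\<sigma> a b. normalizing \<sigma> \<longrightarrow> a - b \<in> L \<longrightarrow> \<sigma> a - \<sigma> b \<in> L) \<and>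
     (\<forall>x y. x - y \<in> Bt \<longrightarrow> x - y \<notin> B \<longrightarrow> orb x y = L) \<and> (\<forall>x y. x - y \<in> Bt \<longrightarrow> K L x = K L y)"
proof -
  \<comment> \<open>Among pairs in different cosets of \<open>B\<close> inside one coset of
    \<open>Bt\<close>, one with the smallest orbit is chosen; this makes the inclusion
    \<open>orb x y \<subseteq> L\<close> below an equality.\<close>
  let ?c = "\<lambda>p. card (orb (fst p) (snd p) \<inter> {0..<n})"
  let ?P = "\<lambda>p. fst p - snd p \<in> Bt \<and> fst p - snd p \<notin> B"
  obtain d where "d \<in> Bt" "d \<notin> B" using B_sub by blast
  then have "?P (d, 0)" by simp
  from ex_has_least_nat[of ?P, OF this, of ?c]
  obtain p where p: "?P p" "\<And>q. ?P q \<Longrightarrow> ?c p \<le> ?c q" by blast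
  define x0 y0 where "x0 = fst p" and "y0 = snd p"
  have xy0: "x0 - y0 \<in> Bt" "x0 - y0 \<notin> B" using p(1) by (simp_all add: x0_def y0_def)
  have least: "card (orb x0 y0 \<inter> {0..<n}) \<le> card (orb x y \<inter> {0..<n})"
    if "x - y \<in> Bt" "x - y \<notin> B" for x y
    using p(2)[of "(x, y)"] that by (simp add: x0_def y0_def)
  define L where "L = orb x0 y0"
  have L: "period_subgroup n L" "L \<subseteq> B" unfolding L_def by (rule orb_psg, rule orb_subset_B)
  have block: "\<sigma> a - \<sigma> b \<in> L" if "normalizing \<sigma>" "a - b \<in> L" for \<sigma> a b
    using orb_block that unfolding L_def by blast
  define E where "E x y \<longleftrightarrow> x - y \<in> Bt \<and> K L x = K L y" for x y
  \<comment> \<open>Conjugation by \<open>\<sigma>\<close> matches \<open>K L x\<close> with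
    \<open>K L (\<sigma> x)\<close> because \<open>\<sigma>\<close> and its inverse respect
    congruence modulo \<open>L\<close>.\<close>
  have sub: "K L (\<sigma> x) \<subseteq> K L (\<sigma> y)" if s: "two_fold \<sigma> w" and eq: "K L x = K L y" for \<sigma> w x y
  proof
    fix \<mu> assume m: "\<mu> \<in> K L (\<sigma> x)"
    note N = normalizing_two_fold[OF s] and sP = two_foldD(1)[OF s]
    note I = normalizing_inv[OF N]
    have "(\<lambda>z. finv \<sigma> (\<mu> (\<sigma> z))) \<in> K L x"
      using K_conj[OF I block[OF I] m] sP by simp
    then have "(\<lambda>z. finv \<sigma> (\<mu> (\<sigma> z))) \<in> K L y" by (simp add: eq)
    from K_conj[OF N block[OF N] this] show "\<mu> \<in> K L (\<sigma> y)" using sP by simp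
  qed
  have E: "E x y" if "x - y \<in> Bt" for x y
  proof (rule minimal[of E, OF _ _ _ _ _ xy0(2) that])
    show "equivp E"
    proof (rule equivpI)
      show "reflp E" by (simp add: reflp_def E_def psg_zero[OF Bt_psg])
      show "symp E" using psg_flip[OF Bt_psg] by (auto simp: symp_def E_def)
      show "transp E" using psg_trans[OF Bt_psg] by (auto simp: transp_def E_def)
    qed
    show "E x y" if "x - y \<in> B" for x y using that B_sub K_coset by (auto simp: E_def)
    show "x - y \<in> Bt" if "E x y" for x y using that by (simp add: E_def)
    show "E (\<sigma> x) (\<sigma> y)" if "two_fold \<sigma> w" "E x y" for \<sigma> w x y
      using sub[OF that(1), of x y] sub[OF that(1), of y x] Bt_block[OF that(1)] that(2)
      by (auto simp: E_def)
    have "K L x0 \<subseteq> K L y0" using K_propagates[OF f L(1), of x0 y0] by (auto simp: L_def)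
    moreover have "K L y0 \<subseteq> K L x0"
      using K_propagates[OF f L(1), of y0 x0] orb_sym[OF f, of y0 x0] by (auto simp: L_def)
    ultimately show "E x0 y0" using xy0(1) by (simp add: E_def)
  qed
  have "orb x y = L" if xy: "x - y \<in> Bt" "x - y \<notin> B" for x y
  proof -
    have sub: "orb x y \<subseteq> L"
    proof
      fix b assume "b \<in> orb x y"
      then obtain \<mu> where m: "\<mu> \<in> K Nz x" "n dvd \<mu> y - y - b" by (auto simp: orb_def)
      have "Nz \<subseteq> L" using psg_dvd[OF L(1)] by blast
      then have "\<mu> \<in> K L x" using K_mono m(1) by blast
      then have "\<mu> \<in> K L y" using E[OF xy(1)] by (simp add: E_def)
      then have "\<mu> y - y \<in> L" by (rule KD) (simp add: psg_zero[OF B_psg])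
      then show "b \<in> L" using psg_dvd[OF L(1) m(2)] psg_cong[OF L(1)] by blast
    qed
    have "card (orb x y \<inter> {0..<n}) \<le> card (L \<inter> {0..<n})"
      by (rule card_mono) (use sub in auto)
    then have "card (orb x y \<inter> {0..<n}) = card (L \<inter> {0..<n})"
      using least[OF xy] by (simp add: L_def)
    then show ?thesis by (intro psg_eq_if_card_eq[OF _ orb_psg L(1)]) (use m_pos in auto)
  qed
  then show ?thesis using L block E by (intro exI[of _ L]) (auto simp: E_def)
qed

text \<open>The choice is not a real one: some pair in \<open>Bt\<close> lies in different cosets of
  \<open>B\<close>, and its orbit is \<open>L\<close>.\<close>

definition L :: "int set" where
  "L = (SOME L. period_subgroup n L \<and> L \<subseteq> B \<and>
     (\<forall>\<sigma> a b. normalizing \<sigma> \<longrightarrow> a - b \<in> L \<longrightarrow> \<sigma> a - \<sigma> b \<in> L) \<and>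
     (\<forall>x y. x - y \<in> Bt \<longrightarrow> x - y \<notin> B \<longrightarrow> orb x y = L) \<and> (\<forall>x y. x - y \<in> Bt \<longrightarrow> K L x = K L y))"

lemma L_psg: "period_subgroup n L"
  and L_B: "L \<subseteq> B"
  and L_block: "normalizing \<sigma> \<Longrightarrow> a - b \<in> L \<Longrightarrow> \<sigma> a - \<sigma> b \<in> L"
  and orb_eq_L: "x - y \<in> Bt \<Longrightarrow> x - y \<notin> B \<Longrightarrow> orb x y = L"
  and K_L: "x - y \<in> Bt \<Longrightarrow> K L x = K L y"
proof -
  note * = someI_ex[OF ex_common_orb, folded L_def]
  show "period_subgroup n L" "L \<subseteq> B" using * by simp_all
  show "normalizing \<sigma> \<Longrightarrow> a - b \<in> L \<Longrightarrow> \<sigma> a - \<sigma> b \<in> L" using * by simp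
  show "x - y \<in> Bt \<Longrightarrow> x - y \<notin> B \<Longrightarrow> orb x y = L" using * by simp
  show "x - y \<in> Bt \<Longrightarrow> K L x = K L y" using * by simp
qed

text \<open>The map \<open>\<nu>\<close> copies the action of \<open>\<mu>\<close> on
  \<open>B\<close> to all cosets, so \<open>\<mu>\<close> followed by the inverse of
  \<open>\<nu>\<close> is trivial on \<open>B\<close>. It thus lies in \<open>K L 0\<close>, which
  equals \<open>K L z\<close>.\<close>

lemma CF_diagonal:
  assumes m: "\<mu> \<in> CF B" and z: "z \<in> Bt"
  shows "\<mu> z - (\<mu> (z - f z) + f z) \<in> L"
proof -
  define \<nu> where "\<nu> u = \<mu> (u - f u) + f u" for u
  have vC: "\<nu> \<in> CF B" unfolding \<nu>_def using replacesD(4)[OF f m] .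
  note vP = CFD(1)[OF vC]
  have "\<nu> u = \<mu> u" if "u - 0 \<in> B" for u using replacesD(3)[OF f] that by (simp add: \<nu>_def)
  then have "finv \<nu> (\<mu> u) = u" if "u - 0 \<in> B" for u using that Per_inv_left[OF vP, of u] by simp
  then have "(\<lambda>u. finv \<nu> (\<mu> u)) \<in> K L 0"
    using CF_comp[OF B_psg CF_inv[OF B_psg vC] m] psg_zero[OF L_psg] by (simp add: K_def)
  then have "(\<lambda>u. finv \<nu> (\<mu> u)) \<in> K L z" using K_L[of z 0] z by simp
  then have "finv \<nu> (\<mu> z) - z \<in> L" using KD[of "\<lambda>u. finv \<nu> (\<mu> u)" L z z] psg_zero[OF B_psg] by simp
  from L_block[OF normalizing_CF[OF vC] this] have "\<mu> z - \<nu> z \<in> L" using vP by simp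
  then show ?thesis by (simp add: \<nu>_def)
qed

text \<open>
  Modulo \<open>L\<close>, translation by \<open>c = f (u + a) - f u\<close> from one coset of \<open>B\<close> to another commutes with \<open>CF B\<close>, so
  its conjugate by \<open>\<sigma>\<close> commutes with the translations by \<open>B\<close> and is itself a translation.
\<close>

lemma conj_translation:
  assumes s: "two_fold \<sigma> w" "\<sigma> \<in> CF Bt" and a: "a \<in> Bt" and x: "x \<in> Bt"
  shows "\<exists>\<delta>\<in>CF B. \<exists>k\<in>Bt. \<forall>z. z - x \<in> B \<longrightarrow> \<sigma> (finv \<sigma> z + a) - \<delta> (z + k) \<in> L"
proof -
  note sP = two_foldD(1)[OF s(1)] and N = normalizing_two_fold[OF s(1)]
  define u where "u = finv \<sigma> x"
  \<comment> \<open>Unlike \<open>a\<close>, the difference \<open>c\<close> carries representative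
    to representative, hence commutes with the diagonal action modulo \<open>L\<close>.\<close>
  define c where "c = f (u + a) - f u"
  define \<psi> where "\<psi> z = \<sigma> (finv \<sigma> z + c)" for z
  have u: "u \<in> Bt"
    using CFD(2)[OF CF_inv[OF Bt_psg s(2)], of x] x psg_cong[OF Bt_psg] by (auto simp: u_def)
  have "c - a = (f (u + a) - (u + a)) - (f u - u)" by (simp add: c_def)
  also have "\<dots> \<in> B" using replacesD(1)[OF f] psg_diff[OF B_psg] by blast
  finally have ca: "c - a \<in> B" .
  then have ac: "a - c \<in> B" using psg_flip[OF B_psg] by blast
  have c: "c \<in> Bt" using ca a B_sub psg_cong[OF Bt_psg] by blast
  have comm: "\<mu> (v + c) - (\<mu> v + c) \<in> L" if m: "\<mu> \<in> CF B" and v: "v - u \<in> B" for \<mu> v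
  proof -
    have vB: "v \<in> Bt" using v u B_sub psg_cong[OF Bt_psg] by blast
    have "(v + c) - (u + a) \<in> B" using psg_add[OF B_psg v ca] by (simp add: algebra_simps)
    then have "f (v + c) = f (u + a)" by (rule replacesD(2)[OF f])
    then have fc: "f (v + c) = f v + c" using replacesD(2)[OF f v] by (simp add: c_def)
    have "\<mu> (v + c) - (\<mu> (v - f v) + (f v + c)) \<in> L"
      using CF_diagonal[OF m psg_add[OF Bt_psg vB c]] by (simp add: fc)
    from psg_diff[OF L_psg this CF_diagonal[OF m vB]] show ?thesis by (simp add: algebra_simps)
  qed
  have trans: "\<psi> (x + b) - (\<psi> x + b) \<in> L" if b: "b \<in> B" for b
  proof -
    define \<mu> where "\<mu> z = finv \<sigma> (\<sigma> z + b)" for z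
    have "\<mu> \<in> CF B" unfolding \<mu>_def using normalizingD(4)[OF N CF_trans[OF b]] .
    from comm[OF this, of u] have "\<mu> (u + c) - (\<mu> u + c) \<in> L" using psg_zero[OF B_psg] by simp
    then have "(\<mu> u + c) - \<mu> (u + c) \<in> L" using psg_flip[OF L_psg] by blast
    from L_block[OF N this] show ?thesis using sP by (simp add: \<psi>_def \<mu>_def u_def)
  qed
  \<comment> \<open>The discrepancy \<open>a - c\<close> lies in \<open>B\<close>, so its conjugate
    is in \<open>CF B\<close>; composed with \<open>\<psi>\<close> it gives the conjugate of the
    translation by \<open>a\<close>.\<close>
  define \<delta> where "\<delta> z = \<sigma> (finv \<sigma> z + (a - c))" for z
  have lC: "\<delta> \<in> CF B" unfolding \<delta>_def using normalizingD(3)[OF N CF_trans[OF ac]] .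
  define k where "k = \<psi> x - x"
  have "k \<in> Bt" using Bt_block[OF s(1), of "u + c" u] c sP by (simp add: k_def \<psi>_def u_def)
  moreover have "\<sigma> (finv \<sigma> z + a) - \<delta> (z + k) \<in> L" if "z - x \<in> B" for z
  proof -
    have "\<psi> z - (z + k) \<in> L" using trans[OF that] by (simp add: k_def algebra_simps)
    from L_block[OF normalizing_CF[OF lC] this] show ?thesis using sP by (simp add: \<delta>_def \<psi>_def)
  qed
  ultimately show ?thesis using lC by blast
qed

text \<open>Some \<open>\<kappa>\<close> fixes \<open>?P\<close> and moves \<open>?Q\<close> by
  \<open>l\<close>, modulo \<open>n\<close>. Spread over the cosets of \<open>Bt\<close> by
  \<open>g\<close>, it fixes \<open>p\<close> and moves \<open>q\<close> by \<open>l\<close>, even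
  if these lie in different cosets of \<open>Bt\<close>.\<close>

lemma Sr_L_invariant:
  assumes "(p - g p) - (q - g q) \<notin> B" "l \<in> L"
  shows "q + l - p \<in> Sr \<longleftrightarrow> q - p \<in> Sr"
proof -
  let ?P = "p - g p" and ?Q = "q - g q"
  have "?P - ?Q = (g q - q) - (g p - p)" by simp
  also have "\<dots> \<in> Bt" using replacesD(1)[OF g] psg_diff[OF Bt_psg] by blast
  finally have "l \<in> orb ?P ?Q" using orb_eq_L assms by blast
  then obtain \<kappa> where k: "\<kappa> \<in> K Nz ?P" "n dvd \<kappa> ?Q - ?Q - l" by (auto simp: orb_def)
  have kp: "n dvd \<kappa> ?P - ?P" using KD[OF k(1), of ?P] psg_zero[OF B_psg] by simp
  have "q - p \<in> Sr \<longleftrightarrow> (\<kappa> ?Q + g q) - (\<kappa> ?P + g p) \<in> Sr"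
    using CFD(3)[OF replacesD(4)[OF g CF_B_Bt[OF K_CF[OF k(1)]]], of q p] .
  also have "\<dots> \<longleftrightarrow> q + l - p \<in> Sr"
    by (rule Sr_cong) (use dvd_diff[OF k(2) kp] in \<open>simp add: algebra_simps\<close>)
  finally show ?thesis by simp
qed

text \<open>The set \<open>U\<close> contains one coset of \<open>B\<close> from each coset of
  \<open>Bt\<close>. The glued map acts like \<open>\<pi>\<close> on \<open>U\<close> and like
  \<open>\<delta>\<close> elsewhere. Relative to \<open>lg\<close>, an edge crossing the boundary of
  \<open>U\<close> has one end moved by an element of \<open>L\<close>, which \<open>Sr\<close> does
  not notice. So the glued map is in \<open>CF B\<close>, and on \<open>B\<close> it is the twisted
  map \<open>\<pi>\<close>.\<close>

lemma iso_if_agrees_mod_L: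
  assumes p: "two_fold \<pi> w" "\<pi> \<in> CF Bt" "w 0" and l: "\<delta> \<in> CF B"
    and agree: "\<And>z. z \<in> B \<Longrightarrow> \<pi> z - \<delta> z \<in> L"
  shows "\<exists>\<phi>\<in>Per n. \<forall>x y. y - x \<in> S \<longleftrightarrow> \<phi> y - \<phi> x + m \<in> S"
proof -
  define U where "U = {z. z - g z \<in> B}"
  define pg where "pg z = \<pi> (z - g z) + g z" for z
  define lg where "lg z = \<delta> (z - g z) + g z" for z
  define \<sigma> where "\<sigma> z = (if z \<in> U then pg z else lg z)" for z
  have pgC: "pg \<in> CF Bt" unfolding pg_def using replacesD(4)[OF g p(2)] .
  have lgC: "lg \<in> CF Bt" unfolding lg_def using replacesD(4)[OF g CF_B_Bt[OF l]] .
  have "\<pi> 0 - \<delta> 0 \<in> B" using agree psg_zero[OF B_psg] L_B by blast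
  then have p0: "\<pi> 0 \<in> B" using CFD(2)[OF l, of 0] psg_cong[OF B_psg] by simp
  have pB: "\<pi> z \<in> B \<longleftrightarrow> z \<in> B" for z
    using normalizingD(2)[OF normalizing_two_fold[OF p(1)], of z 0] p0 psg_cong[OF B_psg, of "\<pi> z - \<pi> 0" "\<pi> z"]
      psg_uminus_iff[OF B_psg] by simp
  have lB: "\<delta> z \<in> B \<longleftrightarrow> z \<in> B" for z using psg_cong[OF B_psg CFD(2)[OF l]] .
  have gpg: "g (pg z) = g z" and glg: "g (lg z) = g z" for z
    using replacesD(2)[OF g] CFD(2)[OF pgC] CFD(2)[OF lgC] by blast+
  have pgU: "pg z \<in> U \<longleftrightarrow> z \<in> U" for z
    using gpg[of z] pB by (simp add: U_def) (simp add: pg_def pB)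
  have lgU: "lg z \<in> U \<longleftrightarrow> z \<in> U" for z
    using glg[of z] lB by (simp add: U_def) (simp add: lg_def lB)
  have "bij \<sigma>" unfolding \<sigma>_def
    using bij_glue[OF Per_bij[OF CFD(1)[OF pgC]] pgU Per_bij[OF CFD(1)[OF lgC]] lgU] .
  moreover have "\<sigma> (z + n) = \<sigma> z + n" for z
  proof -
    have "g (z + n) = g z" by (rule replacesD(2)[OF g]) (simp add: psg_period[OF Bt_psg, simplified])
    then have "z + n \<in> U \<longleftrightarrow> z \<in> U"
      using psg_add_right[OF B_psg psg_period[OF B_psg], of "z - g z"] by (simp add: U_def algebra_simps)
    then show ?thesis using CFD(1)[OF pgC] CFD(1)[OF lgC] by (simp add: \<sigma>_def Per_def)
  qed
  moreover have "\<sigma> z - z \<in> B" for z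
  proof (cases "z \<in> U")
    case True
    then have "\<pi> (z - g z) - (z - g z) \<in> B" using pB psg_diff[OF B_psg] by (simp add: U_def)
    then show ?thesis using True by (simp add: \<sigma>_def pg_def algebra_simps)
  next
    case False
    then show ?thesis using CFD(2)[OF l, of "z - g z"] by (simp add: \<sigma>_def lg_def algebra_simps)
  qed
  moreover have "y - x \<in> Sr \<longleftrightarrow> \<sigma> y - \<sigma> x \<in> Sr" for x y
  proof -
    have near: "pg z - lg z \<in> L" if "z \<in> U" for z
      using agree that by (simp add: U_def pg_def lg_def)
    have far: "(lg x - g (lg x)) - (lg y - g (lg y)) \<notin> B" if "x \<in> U \<longleftrightarrow> y \<notin> U"
      using that lgU[of x] lgU[of y] psg_cong[OF B_psg, of "lg x - g (lg x)" "lg y - g (lg y)"]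
      by (auto simp: U_def)
    consider "x \<in> U" "y \<in> U" | "x \<notin> U" "y \<notin> U" | "x \<in> U" "y \<notin> U" | "x \<notin> U" "y \<in> U" by blast
    then show ?thesis
    proof cases
      case 1 then show ?thesis using CFD(3)[OF pgC] by (simp add: \<sigma>_def)
    next
      case 2 then show ?thesis using CFD(3)[OF lgC] by (simp add: \<sigma>_def)
    next
      case 3
      have "lg y + (lg x - pg x) - lg x \<in> Sr \<longleftrightarrow> lg y - lg x \<in> Sr"
        by (rule Sr_L_invariant) (use far 3 near[of x] psg_flip[OF L_psg] in auto)
      then show ?thesis using CFD(3)[OF lgC, of y x] 3 by (simp add: \<sigma>_def)
    next
      case 4
      have "lg y + (pg y - lg y) - lg x \<in> Sr \<longleftrightarrow> lg y - lg x \<in> Sr"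
        by (rule Sr_L_invariant) (use far 4 near[of y] in auto)
      then show ?thesis using CFD(3)[OF lgC, of y x] 4 by (simp add: \<sigma>_def)
    qed
  qed
  ultimately have "\<sigma> \<in> CF B" by (simp add: CF_def Per_def)
  then show ?thesis
  proof (rule iso_if_twisted_on_subgroup[OF B_psg subset_refl f])
    fix x y assume xy: "x \<in> B" "y \<in> B"
    have s: "\<sigma> z = \<pi> z" if "z \<in> B" for z
      using replacesD(3)[OF g, of z] that B_sub by (auto simp: \<sigma>_def U_def pg_def)
    have "w y = w 0" using B_diff_iff[of y 0] xy p(1) by auto
    then show "y - x \<in> S \<longleftrightarrow> \<sigma> y - \<sigma> x + m \<in> S"
      using two_foldD(4)[OF p(1), of y x] p(3) s xy by (simp add: half_def)
  qed
qed

text \<open>Translating by \<open>x\<close> before and by \<open>- (x + k)\<close> after moves the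
  point with nonzero cocycle to 0 and replaces \<open>\<delta>\<close> by a conjugate under a
  translation.\<close>

lemma iso_if_agrees_with_translate:
  assumes v: "two_fold \<nu> w" "\<nu> \<in> CF Bt" "w x" and l: "\<delta> \<in> CF B" and k: "k \<in> Bt"
    and agree: "\<And>z. z - x \<in> B \<Longrightarrow> \<nu> z - \<delta> (z + k) \<in> L"
  shows "\<exists>\<phi>\<in>Per n. \<forall>x y. y - x \<in> S \<longleftrightarrow> \<phi> y - \<phi> x + m \<in> S"
proof (rule iso_if_agrees_mod_L)
  show t: "two_fold (\<lambda>z. \<nu> (z + x) - (x + k)) (\<lambda>z. w (z + x))"
    using two_fold_comp[OF two_fold_trans[of "- (x + k)"] two_fold_shift[OF v(1), of x]]
    by (simp add: algebra_simps)
  have "\<nu> (z + x) - (x + k) - z \<in> Bt" for z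
    using psg_diff[OF Bt_psg CFD(2)[OF v(2), of "z + x"] k] by (simp add: algebra_simps)
  moreover have "b - a \<in> Sr \<longleftrightarrow> (\<nu> (b + x) - (x + k)) - (\<nu> (a + x) - (x + k)) \<in> Sr" for a b
    using CFD(3)[OF v(2), of "b + x" "a + x"] by simp
  ultimately show "(\<lambda>z. \<nu> (z + x) - (x + k)) \<in> CF Bt"
    using two_foldD(1)[OF t] unfolding CF_def by blast
  show "w (0 + x)" using v(3) by simp
  show "(\<lambda>z. \<delta> (z + (x + k)) - (x + k)) \<in> CF B" using CF_trans_conj[OF l] .
  show "\<nu> (z + x) - (x + k) - (\<delta> (z + (x + k)) - (x + k)) \<in> L" if "z \<in> B" for z
    using agree[of "z + x"] that by (simp add: add.assoc)
qed

text \<open>Otherwise conjugates of translations by \<open>a\<close> in \<open>Bt\<close> have zero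
  cocycle. At \<open>\<sigma> 0\<close> this cocycle compares \<open>w a\<close> with
  \<open>w 0\<close>, so \<open>a\<close> would be a common period and \<open>Bt\<close> would be
  contained in \<open>B\<close>.\<close>

lemma ex_twisting_fixing_cosets: "\<exists>\<sigma> w x. two_fold \<sigma> w \<and> \<sigma> \<in> CF Bt \<and> x \<in> Bt \<and> w x"
proof (rule ccontr)
  assume no: "\<not> ?thesis"
  \<comment> \<open>Conjugation by the translation by \<open>x\<close> extends the vanishing from
    \<open>Bt\<close> to all points.\<close>
  have zero: "\<not> w x" if s: "two_fold \<sigma> w" "\<sigma> \<in> CF Bt" for \<sigma> w x
  proof -
    have t: "two_fold (\<lambda>z. \<sigma> (z + x) - x) (\<lambda>z. w (z + x))"
      using two_fold_comp[OF two_fold_trans[of "- x"] two_fold_shift[OF s(1), of x]] by simp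
    from no t CF_trans_conj[OF s(2), of x] psg_zero[OF Bt_psg] have "\<not> w (0 + x)" by blast
    then show ?thesis by simp
  qed
  have "a \<in> B" if a: "a \<in> Bt" for a
  proof -
    have "w a = w 0" if s: "two_fold \<sigma> w" for \<sigma> w
    proof -
      have t: "two_fold (\<lambda>x. \<sigma> (finv \<sigma> x + a)) (\<lambda>x. w (finv \<sigma> x + a) \<noteq> w (finv \<sigma> x))"
        using two_fold_comp[OF two_fold_shift[OF s, of a] two_fold_inv[OF s]] by simp
      have "(\<lambda>x. \<sigma> (finv \<sigma> x + a)) \<in> CF Bt"
        using CF_conj[OF s Bt_block[OF s] CF_trans[OF a]] .
      from zero[OF t this, of "\<sigma> 0"] show ?thesis using two_foldD(1)[OF s] by simp
    qed
    then show ?thesis by (simp add: B_def)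
  qed
  then show False using B_sub by blast
qed

theorem ex_twisted_permutation: "\<exists>\<phi>\<in>Per n. \<forall>x y. y - x \<in> S \<longleftrightarrow> \<phi> y - \<phi> x + m \<in> S"
proof (cases "\<exists>\<sigma> w a x. two_fold \<sigma> w \<and> \<sigma> \<in> CF Bt \<and> a \<in> Bt \<and> x \<in> Bt \<and> w (finv \<sigma> x + a) \<noteq> w (finv \<sigma> x)")
  case True
  then obtain \<sigma> w a x where s: "two_fold \<sigma> w" "\<sigma> \<in> CF Bt" and a: "a \<in> Bt" and x: "x \<in> Bt"
    and w: "w (finv \<sigma> x + a) \<noteq> w (finv \<sigma> x)" by blast
  obtain \<delta> k where l: "\<delta> \<in> CF B" "k \<in> Bt" and agree: "\<And>z. z - x \<in> B \<Longrightarrow> \<sigma> (finv \<sigma> z + a) - \<delta> (z + k) \<in> L"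
    using conj_translation[OF s a x] by blast
  show ?thesis
  proof (rule iso_if_agrees_with_translate[where \<nu> = "\<lambda>x. \<sigma> (finv \<sigma> x + a)"
        and w = "\<lambda>x. w (finv \<sigma> x + a) \<noteq> w (finv \<sigma> x)", OF _ _ w l agree])
    show "two_fold (\<lambda>x. \<sigma> (finv \<sigma> x + a)) (\<lambda>x. w (finv \<sigma> x + a) \<noteq> w (finv \<sigma> x))"
      using two_fold_comp[OF two_fold_shift[OF s(1), of a] two_fold_inv[OF s(1)]] by simp
    show "(\<lambda>x. \<sigma> (finv \<sigma> x + a)) \<in> CF Bt"
      using CF_conj[OF s(1) Bt_block[OF s(1)] CF_trans[OF a]] .
  qed
next
  case False
  obtain \<sigma> w x where s: "two_fold \<sigma> w" "\<sigma> \<in> CF Bt" and x: "x \<in> Bt" "w x"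
    using ex_twisting_fixing_cosets by blast
  have w: "w y" if y: "y \<in> Bt" for y
  proof -
    \<comment> \<open>The failed case, taken at the point \<open>\<sigma> x\<close> with
      \<open>a = y - x\<close>, compares the cocycle at \<open>y\<close> with that at
      \<open>x\<close>.\<close>
    have "\<sigma> x \<in> Bt" using psg_cong[OF Bt_psg CFD(2)[OF s(2)]] x by simp
    moreover have "y - x \<in> Bt" using psg_diff[OF Bt_psg y x(1)] .
    ultimately have "w (finv \<sigma> (\<sigma> x) + (y - x)) = w (finv \<sigma> (\<sigma> x))" using False s by blast
    then show ?thesis using x(2) two_foldD(1)[OF s(1)] by simp
  qed
  show ?thesis
  proof (rule iso_if_twisted_on_subgroup[OF Bt_psg _ g s(2)])
    show "B \<subseteq> Bt" using B_sub by blast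
    show "y - x \<in> S \<longleftrightarrow> \<sigma> y - \<sigma> x + m \<in> S" if "x \<in> Bt" "y \<in> Bt" for x y
      using two_foldD(4)[OF s(1), of y x] w[OF that(2)] by (simp add: half_def)
  qed
qed

end

section \<open>Two-fold automorphisms of graphs\<close>

lemma inj_imp_permutes:
  assumes "finite A" "inj_on p A" "p ` A \<subseteq> A" "\<And>x. x \<notin> A \<Longrightarrow> p x = x"
  shows "p permutes A"
  using assms endo_inj_surj[of A p] by (intro bij_imp_permutes) (auto simp: bij_betw_def)

text \<open>Connectedness refers to the symmetrized digraph; equality of values passes along arcs in
  both directions.\<close>

lemma constant_if_connected:
  assumes conn: "Digraph_Component.connected (with_proj G)"
    and P: "\<And>x y. (x, y) \<in> parcs G \<Longrightarrow> P x = P y"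
    and xy: "x \<in> pverts G" "y \<in> pverts G"
  shows "P x = P y"
proof -
  let ?M = "mk_symmetric (with_proj G)"
  have "x \<rightarrow>\<^sup>*\<^bsub>with_proj ?M\<^esub> y"
    using conn xy by (simp add: connected_def strongly_connected_def)
  then have "(x, y) \<in> rtrancl_on (pverts G) (parcs ?M)" by (simp add: reachable_def)
  then show ?thesis
  proof (induction rule: rtrancl_on_induct)
    case (step u v)
    from step(2) have "(u, v) \<in> parcs G \<or> (v, u) \<in> parcs G" by (auto simp: parcs_mk_symmetric)
    then show ?case using step P by metis
  qed simp
qed

lemma two_fold_aut_comp:
  assumes s: "two_fold_aut G \<sigma>\<^sub>1 \<sigma>\<^sub>2" and t: "two_fold_aut G \<tau>\<^sub>1 \<tau>\<^sub>2"
  shows "two_fold_aut G (\<sigma>\<^sub>1 \<circ> \<tau>\<^sub>1) (\<sigma>\<^sub>2 \<circ> \<tau>\<^sub>2)"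
proof -
  have "\<tau>\<^sub>1 x \<in> pverts G" "\<tau>\<^sub>2 x \<in> pverts G" if "x \<in> pverts G" for x
    using t that by (auto simp: two_fold_aut_def permutes_in_image)
  then show ?thesis using s t by (auto simp: two_fold_aut_def permutes_compose)
qed

lemma pverts_times_K2: "pverts (times_K2 G) = pverts G \<times> {0, 1}"
  by (simp add: times_K2_def)

lemma parcs_times_K2:
  "((x, i), (y, j)) \<in> parcs (times_K2 G) \<longleftrightarrow> (x, y) \<in> parcs G \<and> i \<in> {0, 1} \<and> j \<in> {0, 1} \<and> i \<noteq> j"
  by (simp add: times_K2_def)

text \<open>Arcs from side 1 to side 0 are handled by symmetry. The last case of \<open>h\<close>
  serves the convention of \<open>permutes\<close> outside the vertex set.\<close>

lemma two_fold_aut_imp_graph_aut: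
  assumes s: "two_fold_aut G \<sigma> \<tau>" and fin: "finite (pverts G)" and sym: "sym (parcs G)"
  defines "h \<equiv> \<lambda>(v, i). if i = (0::nat) then (\<sigma> v, i) else if i = 1 then (\<tau> v, i) else (v, i)"
  shows "h \<in> graph_aut (times_K2 G)"
proof -
  have p: "\<sigma> permutes pverts G" "\<tau> permutes pverts G"
    and e: "\<And>x y. x \<in> pverts G \<Longrightarrow> y \<in> pverts G \<Longrightarrow> (x, y) \<in> parcs G \<longleftrightarrow> (\<sigma> x, \<tau> y) \<in> parcs G"
    using s by (auto simp: two_fold_aut_def)
  have e': "(x, y) \<in> parcs G \<longleftrightarrow> (\<tau> x, \<sigma> y) \<in> parcs G" if "x \<in> pverts G" "y \<in> pverts G" for x y
    using e[OF that(2,1)] sym by (auto dest: symD)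
  define r where "r i = (if i = (0::nat) then \<sigma> else \<tau>)" for i
  have r: "r i permutes pverts G" for i using p by (simp add: r_def)
  have h: "h (v, i) = (r i v, i)" if "i \<in> {0, 1}" for v i using that by (auto simp: h_def r_def)
  have "h permutes pverts (times_K2 G)"
  proof (rule inj_imp_permutes)
    show "finite (pverts (times_K2 G))" using fin by (simp add: pverts_times_K2)
    show "inj_on h (pverts (times_K2 G))"
    proof (rule inj_onI)
      fix u v assume "u \<in> pverts (times_K2 G)" "v \<in> pverts (times_K2 G)" and eq: "h u = h v"
      then obtain x i y j where u: "u = (x, i)" "i \<in> {0, 1}" and v: "v = (y, j)" "j \<in> {0, 1}"
        by (auto simp: pverts_times_K2)
      from eq have "i = j \<and> r i x = r j y" using h[OF u(2)] h[OF v(2)] by (auto simp: u(1) v(1))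
      then have "i = j" "x = y" using injD[OF permutes_inj[OF r], of j x y] by auto
      then show "u = v" using u v by simp
    qed
    show "h ` pverts (times_K2 G) \<subseteq> pverts (times_K2 G)"
    proof
      fix v assume "v \<in> h ` pverts (times_K2 G)"
      then obtain x i where "x \<in> pverts G" "i \<in> {0, 1}" "v = h (x, i)"
        unfolding pverts_times_K2 by blast
      then show "v \<in> pverts (times_K2 G)" using h permutes_in_image[OF r, of i x] by (simp add: pverts_times_K2)
    qed
    show "h v = v" if "v \<notin> pverts (times_K2 G)" for v
    proof (cases v)
      case (Pair x i)
      then show ?thesis using that h[of i x] permutes_not_in[OF r, of x i]
        by (cases "i \<in> {0, 1}") (auto simp: pverts_times_K2 h_def)
    qed
  qed
  moreover have "(u, v) \<in> parcs (times_K2 G) \<longleftrightarrow> (h u, h v) \<in> parcs (times_K2 G)"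
    if uv: "u \<in> pverts (times_K2 G)" "v \<in> pverts (times_K2 G)" for u v
  proof -
    obtain x i y j where *: "u = (x, i)" "i \<in> {0, 1}" "v = (y, j)" "j \<in> {0, 1}" "x \<in> pverts G" "y \<in> pverts G"
      using uv unfolding pverts_times_K2 by blast
    have "i \<noteq> j \<longrightarrow> ((x, y) \<in> parcs G \<longleftrightarrow> (r i x, r j y) \<in> parcs G)"
      using e[OF *(5,6)] e'[OF *(5,6)] *(2,4) by (auto simp: r_def)
    then show ?thesis using h *(2,4) unfolding *(1,3) by (auto simp: parcs_times_K2)
  qed
  ultimately show ?thesis by (simp add: graph_aut_def)
qed

text \<open>
  Both endpoints of an edge change sides together, so the set of vertices whose side is changed is
  constant along edges up to exchanging the sides. It avoids both vertices over \<open>o'\<close>.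
\<close>

lemma graph_aut_imp_two_fold_aut:
  assumes h: "h \<in> graph_aut (times_K2 G)" and fin: "finite (pverts G)"
    and conn: "Digraph_Component.connected (with_proj G)" and wf: "parcs G \<subseteq> pverts G \<times> pverts G"
    and o: "o' \<in> pverts G" "snd (h (o', 0)) = 0" "snd (h (o', 1)) = 1"
  obtains \<sigma> \<tau> where "two_fold_aut G \<sigma> \<tau>" "\<sigma> o' = fst (h (o', 0))" "\<tau> o' = fst (h (o', 1))"
proof -
  let ?V = "pverts G"
  have p: "h permutes ?V \<times> {0, 1}"
    and e: "\<And>u v. u \<in> ?V \<times> {0, 1} \<Longrightarrow> v \<in> ?V \<times> {0, 1} \<Longrightarrow>
      (u, v) \<in> parcs (times_K2 G) \<longleftrightarrow> (h u, h v) \<in> parcs (times_K2 G)"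
    using h unfolding graph_aut_def pverts_times_K2 by blast+
  have hV: "h (x, i) \<in> ?V \<times> {0, 1}" if "x \<in> ?V" "i \<in> {0, 1}" for x i
    using that permutes_in_image[OF p] by blast
  define c0 where "c0 x \<longleftrightarrow> snd (h (x, 0)) \<noteq> 0" for x
  define c1 where "c1 x \<longleftrightarrow> snd (h (x, 1)) \<noteq> 1" for x
  have c: "c0 x = c1 y" "c1 x = c0 y" if xy: "(x, y) \<in> parcs G" for x y
  proof -
    have V: "x \<in> ?V" "y \<in> ?V" using xy wf by auto
    have "(h (x, 0), h (y, 1)) \<in> parcs (times_K2 G)" "(h (x, 1), h (y, 0)) \<in> parcs (times_K2 G)"
      using e[of "(x, 0)" "(y, 1)"] e[of "(x, 1)" "(y, 0)"] V xy by (auto simp: parcs_times_K2)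
    then have "snd (h (x, 0)) \<in> {0, 1}" "snd (h (y, 1)) \<in> {0, 1}" "snd (h (x, 0)) \<noteq> snd (h (y, 1))"
      "snd (h (x, 1)) \<in> {0, 1}" "snd (h (y, 0)) \<in> {0, 1}" "snd (h (x, 1)) \<noteq> snd (h (y, 0))"
      by (auto simp: times_K2_def)
    then show "c0 x = c1 y" "c1 x = c0 y" by (auto simp: c0_def c1_def)
  qed
  \<comment> \<open>Whether \<open>c0\<close> and \<open>c1\<close> agree is unaffected by
    exchanging the sides, so this is propagated first; after that \<open>c0\<close> itself is
    constant along edges.\<close>
  have "(c0 x = c1 x) = (c0 o' = c1 o')" if "x \<in> ?V" for x
    by (rule constant_if_connected[OF conn _ that o(1)]) (use c in blast)
  then have c01: "c0 x = c1 x" if "x \<in> ?V" for x using that o by (simp add: c0_def c1_def)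
  have "c0 x = c0 o'" if "x \<in> ?V" for x
    by (rule constant_if_connected[OF conn _ that o(1)]) (use c c01 wf in blast)
  then have side: "snd (h (x, i)) = i" if "x \<in> ?V" "i \<in> {0, 1}" for x i
    using that c01[of x] o by (auto simp: c0_def c1_def)
  define s where "s i x = (if x \<in> ?V then fst (h (x, i)) else x)" for i x
  have hs: "h (x, i) = (s i x, i)" if "x \<in> ?V" "i \<in> {0, 1}" for x i
    using side[OF that] that by (simp add: s_def prod_eq_iff)
  have perm: "s i permutes ?V" if i: "i \<in> {0, 1}" for i
  proof (rule inj_imp_permutes[OF fin])
    show "inj_on (s i) ?V"
    proof (rule inj_onI)
      fix x y assume xy: "x \<in> ?V" "y \<in> ?V" "s i x = s i y"
      then have "h (x, i) = h (y, i)" using hs i by simp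
      then show "x = y" using permutes_inj[OF p] by (auto dest: injD)
    qed
    show "s i ` ?V \<subseteq> ?V" using hV[OF _ i] by (auto simp: s_def mem_Times_iff)
  qed (simp add: s_def)
  have "(x, y) \<in> parcs G \<longleftrightarrow> (s 0 x, s 1 y) \<in> parcs G" if "x \<in> ?V" "y \<in> ?V" for x y
    using e[of "(x, 0)" "(y, 1)"] that hs by (simp add: parcs_times_K2)
  then have "two_fold_aut G (s 0) (s 1)" using perm by (simp add: two_fold_aut_def)
  then show thesis using that o(1) by (simp add: s_def)
qed

text \<open>As \<open>\<sigma>\<close> is onto, the neighbourhoods of \<open>\<tau> y\<close> and
  \<open>\<tau>' y\<close> coincide, and reducedness identifies the two vertices.\<close>

lemma two_fold_aut_unique:
  assumes red: "reduced G" and wf: "parcs G \<subseteq> pverts G \<times> pverts G" and sym: "sym (parcs G)"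
    and s: "two_fold_aut G \<sigma> \<tau>" and t: "two_fold_aut G \<sigma> \<tau>'"
  shows "\<tau> = \<tau>'"
proof
  fix y
  have p: "\<sigma> permutes pverts G" "\<tau> permutes pverts G" "\<tau>' permutes pverts G"
    using s t by (auto simp: two_fold_aut_def)
  show "\<tau> y = \<tau>' y"
  proof (cases "y \<in> pverts G")
    case True
    then have V: "\<tau> y \<in> pverts G" "\<tau>' y \<in> pverts G" using p by (simp_all add: permutes_in_image)
    have "(\<tau> y, u) \<in> parcs G \<longleftrightarrow> (\<tau>' y, u) \<in> parcs G" for u
    proof (cases "u \<in> pverts G")
      case u: True
      obtain x where x: "u = \<sigma> x" "x \<in> pverts G"
        using u permutes_surj[OF p(1)] permutes_in_image[OF p(1)] by (metis surj_def)
      have "(\<sigma> x, \<tau> y) \<in> parcs G \<longleftrightarrow> (\<sigma> x, \<tau>' y) \<in> parcs G"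
        using s t True x(2) by (auto simp: two_fold_aut_def)
      then show ?thesis using sym x(1) by (auto dest: symD)
    qed (use wf in auto)
    then have "parcs G `` {\<tau> y} = parcs G `` {\<tau>' y}" by auto
    then show ?thesis using red V by (auto simp: reduced_def dest: inj_onD)
  next
    case False then show ?thesis using p by (simp add: permutes_not_in)
  qed
qed

section \<open>Partitions compared through their equivalence relations\<close>

lemma quotient_eq_imp_eq:
  assumes "equiv A r" "equiv A s" "A // r = A // s" shows "r = s"
proof -
  have sub: "r \<subseteq> s" if r: "equiv A r" and s: "equiv A s" and eq: "A // r = A // s" for r s
  proof
    fix p assume p: "p \<in> r"
    obtain x y where xy: "p = (x, y)" by force
    have A: "x \<in> A" "y \<in> A" using r p xy by (auto simp: equiv_def refl_on_def)
    have "r `` {x} \<in> A // s" using A eq by (metis quotientI)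
    moreover have "x \<in> r `` {x}" "y \<in> r `` {x}" using p xy A r by (auto simp: equiv_def refl_on_def)
    ultimately show "p \<in> s" using xy s by (metis quotient_eq_iff)
  qed
  show ?thesis using sub[OF assms] sub[OF assms(2,1) assms(3)[symmetric]] by blast
qed

lemma refines_quotient:
  assumes r: "equiv A r" and s: "equiv A s" and sub: "r \<subseteq> s"
  shows "refines A (A // r) (A // s)"
proof -
  have "\<exists>Y\<in>A // s. X \<subseteq> Y" if "X \<in> A // r" for X
  proof -
    from that obtain x where x: "x \<in> A" "X = r `` {x}" by (rule quotientE)
    then show ?thesis using sub by (intro bexI[of _ "s `` {x}"]) (auto intro: quotientI)
  qed
  then show ?thesis
    using partition_on_quotient[OF r] partition_on_quotient[OF s] by (simp add: refines_def)
qed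

lemma refines_quotient_imp_subset:
  assumes r: "equiv A r" and s: "equiv A s" and ref: "refines A (A // r) (A // s)"
  shows "r \<subseteq> s"
proof
  fix p assume p: "p \<in> r"
  obtain x y where xy: "p = (x, y)" by force
  have A: "x \<in> A" "y \<in> A" using r p xy by (auto simp: equiv_def refl_on_def)
  obtain Y where Y: "Y \<in> A // s" "r `` {x} \<subseteq> Y"
    using ref A quotientI[of x A r] by (auto simp: refines_def)
  moreover have "x \<in> r `` {x}" "y \<in> r `` {x}" using p xy A r by (auto simp: equiv_def refl_on_def)
  ultimately show "p \<in> s" using xy s by (metis quotient_eq_iff subsetD)
qed

section \<open>Lifting circulant graphs to the integers\<close>

locale half_orbit_circulant =
  fixes m :: nat and T :: "int set"
  assumes m_gt_0: "0 < m"
    and T_sub: "T \<subseteq> carrier (ZMod (2 * m))"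
    and T_sym: "(\<lambda>s. (- s) mod int (2 * m)) ` T = T"
    and conn: "Digraph_Component.connected (with_proj (Cay (2 * m) T))"
    and red: "reduced (Cay (2 * m) T)"
    and orbit: "{h (0, 1) | h. h \<in> graph_aut (times_K2 (Cay (2 * m) T)) \<and> h (0, 0) = (0, 0)}
           = {(0, 1), (int m, 1)}"
begin

abbreviation \<Gamma> :: "int pair_pre_digraph" where "\<Gamma> \<equiv> Cay (2 * m) T"

abbreviation Z :: "int set" where "Z \<equiv> {0..<2 * int m}"

definition PS :: "int set" where "PS = {s. s mod (2 * int m) \<in> T}"

lemma T_neg: "s \<in> T \<Longrightarrow> (- s) mod (2 * int m) \<in> T"
  using T_sym by force

sublocale circulant "int m" PS
proof
  show "0 < int m" using m_gt_0 by simp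
  fix s
  show "s + 2 * int m \<in> PS \<longleftrightarrow> s \<in> PS" by (simp add: PS_def)
  have "- s \<in> PS" if "s \<in> PS" for s
    using T_neg[of "s mod (2 * int m)"] that by (simp add: PS_def mod_minus_eq)
  from this[of s] this[of "- s"] show "- s \<in> PS \<longleftrightarrow> s \<in> PS" by auto
qed

lemma carrier_eq: "carrier (ZMod (2 * m)) = Z"
  using m_gt_0 by (simp add: carrier_integer_mod_group)

lemma pverts_Cay: "pverts (Cay (2 * m) A) = Z"
  by (simp add: Cay_def carrier_eq)

lemma parcs_Cay: "(x, y) \<in> parcs (Cay (2 * m) A) \<longleftrightarrow> x \<in> Z \<and> y \<in> Z \<and> (y - x) mod n \<in> A"
  by (simp add: Cay_def carrier_eq)

lemma parcs_Gamma: "(x, y) \<in> parcs \<Gamma> \<longleftrightarrow> x \<in> Z \<and> y \<in> Z \<and> y - x \<in> PS"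
  by (simp add: parcs_Cay PS_def)

lemma parcs_sub: "parcs \<Gamma> \<subseteq> pverts \<Gamma> \<times> pverts \<Gamma>"
  by (auto simp: Cay_def)

lemma sym_parcs: "sym (parcs \<Gamma>)"
  using S_flip by (auto simp: sym_def parcs_Gamma)

lemma two_fold_aut_iff:
  "two_fold_aut \<Gamma> \<sigma> \<tau> \<longleftrightarrow> \<sigma> permutes Z \<and> \<tau> permutes Z \<and> (\<forall>x\<in>Z. \<forall>y\<in>Z. y - x \<in> PS \<longleftrightarrow> \<tau> y - \<sigma> x \<in> PS)"
  unfolding two_fold_aut_def pverts_Cay
proof (intro conj_cong refl ball_cong)
  fix x y assume "\<sigma> permutes Z" "\<tau> permutes Z" "x \<in> Z" "y \<in> Z"
  then show "((x, y) \<in> parcs \<Gamma> \<longleftrightarrow> (\<sigma> x, \<tau> y) \<in> parcs \<Gamma>) = (y - x \<in> PS \<longleftrightarrow> \<tau> y - \<sigma> x \<in> PS)"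
    using permutes_in_image[of \<sigma> Z x] permutes_in_image[of \<tau> Z y] by (simp add: parcs_Gamma)
qed

lemma dvd_mod: "n dvd x - x mod n"
  by (simp add: minus_mod_eq_mult_div)

lemma mod_dvd: "n dvd x mod n - x"
  using dvd_mod[of x] dvd_diff_commute by blast

lemma mod_Z: "x mod n \<in> Z"
  using m_gt_0 by simp

lemma Z_eqI: "x \<in> Z \<Longrightarrow> y \<in> Z \<Longrightarrow> n dvd x - y \<Longrightarrow> x = y"
  by (metis atLeastLessThan_iff mod_eq_dvd_iff mod_pos_pos_trivial)

definition lift :: "(int \<Rightarrow> int) \<Rightarrow> int \<Rightarrow> int" where
  "lift \<sigma> x = \<sigma> (x mod n) + (x - x mod n)"

definition proj :: "(int \<Rightarrow> int) \<Rightarrow> int \<Rightarrow> int" where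
  "proj \<sigma> x = (if x \<in> Z then \<sigma> x mod n else x)"

lemma lift_Z: "x \<in> Z \<Longrightarrow> lift \<sigma> x = \<sigma> x"
  by (simp add: lift_def)

lemma lift_mod: assumes "\<sigma> permutes Z" shows "lift \<sigma> x mod n = \<sigma> (x mod n)"
proof -
  have "\<sigma> (x mod n) \<in> Z" using permutes_in_image[OF assms] mod_Z by blast
  moreover have "n dvd lift \<sigma> x - \<sigma> (x mod n)" using dvd_mod by (simp add: lift_def)
  ultimately show ?thesis by (metis atLeastLessThan_iff mod_eq_dvd_iff mod_pos_pos_trivial)
qed

text \<open>The lift of the inverse permutation inverts the lift.\<close>

lemma lift_Per: assumes "\<sigma> permutes Z" shows "lift \<sigma> \<in> Per n"
proof -
  have *: "lift (finv \<tau>) (lift \<tau> x) = x" if "\<tau> permutes Z" for \<tau> x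
  proof -
    have "lift (finv \<tau>) (lift \<tau> x) = finv \<tau> (\<tau> (x mod n)) + (lift \<tau> x - \<tau> (x mod n))"
      by (simp only: lift_def[of "finv \<tau>"] lift_mod[OF that])
    then show ?thesis using permutes_inverses[OF that] by (simp add: lift_def)
  qed
  have "bij (lift \<sigma>)"
  proof (rule bijI)
    show "inj (lift \<sigma>)" using *[OF assms] by (rule inj_on_inverseI)
    show "surj (lift \<sigma>)"
      using *[OF permutes_inv[OF assms]] permutes_inv_inv[OF assms] by (intro surjI) simp
  qed
  then show ?thesis by (simp add: Per_def lift_def)
qed

lemma proj_permutes: assumes "\<sigma> \<in> Per n" shows "proj \<sigma> permutes Z"
proof (rule inj_imp_permutes)
  show "inj_on (proj \<sigma>) Z"
  proof (rule inj_onI)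
    fix x y assume xy: "x \<in> Z" "y \<in> Z" and "proj \<sigma> x = proj \<sigma> y"
    then have "n dvd \<sigma> x - \<sigma> y" by (simp add: proj_def mod_eq_dvd_iff)
    from Per_cong[OF Per_inv[OF assms] this] have "n dvd x - y" using assms by simp
    then show "x = y" by (rule Z_eqI[OF xy])
  qed
  show "proj \<sigma> ` Z \<subseteq> Z" using mod_Z by (auto simp: proj_def)
qed (auto simp: proj_def)

definition shift :: "int \<Rightarrow> int \<Rightarrow> int" where "shift a = proj (\<lambda>x. x + a)"

lemma shift_Z: "x \<in> Z \<Longrightarrow> shift a x = (x + a) mod n"
  by (simp add: shift_def proj_def)

lemma two_fold_aut_shift: "two_fold_aut \<Gamma> (shift a) (shift a)"
  unfolding two_fold_aut_iff
proof (intro conjI ballI)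
  show "shift a permutes Z" "shift a permutes Z"
    unfolding shift_def by (rule proj_permutes[OF Per_trans])+
  fix x y assume "x \<in> Z" "y \<in> Z"
  then have "n dvd (y - x) - (shift a y - shift a x)"
    using dvd_diff[OF dvd_mod[of "y + a"] dvd_mod[of "x + a"]] by (simp add: shift_Z algebra_simps)
  then show "y - x \<in> PS \<longleftrightarrow> shift a y - shift a x \<in> PS" by (rule S_cong)
qed

lemma two_fold_aut_orbit:
  assumes s: "two_fold_aut \<Gamma> \<sigma> \<tau>" and 0: "\<sigma> 0 = 0"
  shows "\<tau> 0 \<in> {0, int m}"
proof -
  let ?h = "\<lambda>(v, i). if i = (0::nat) then (\<sigma> v, i) else if i = 1 then (\<tau> v, i) else (v, i)"
  have "?h \<in> graph_aut (times_K2 \<Gamma>)"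
    by (rule two_fold_aut_imp_graph_aut[OF s _ sym_parcs]) (simp add: pverts_Cay)
  then have "?h (0, 1) \<in> {h (0, 1) | h. h \<in> graph_aut (times_K2 \<Gamma>) \<and> h (0, 0) = (0, 0)}"
    using 0 by (intro CollectI exI[of _ ?h]) simp
  then show ?thesis unfolding orbit by simp
qed

text \<open>Shifts before and after move both \<open>x\<close> and \<open>\<sigma> x\<close> to 0,
  where the orbit hypothesis leaves only 0 and \<open>m\<close> for the second component.\<close>

lemma two_fold_aut_half:
  assumes s: "two_fold_aut \<Gamma> \<sigma> \<tau>" and x: "x \<in> Z"
  shows "n dvd \<tau> x - \<sigma> x - half (\<tau> x \<noteq> \<sigma> x)"
proof -
  have p: "\<sigma> permutes Z" "\<tau> permutes Z" using s by (auto simp: two_fold_aut_iff)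
  have V: "\<sigma> x \<in> Z" "\<tau> x \<in> Z" using p x by (simp_all only: permutes_in_image)
  have 0: "0 \<in> Z" using m_gt_0 by simp
  let ?a = "- \<sigma> x"
  have sx: "shift x 0 = x" using x 0 by (simp add: shift_Z)
  have "two_fold_aut \<Gamma> (shift ?a \<circ> (\<sigma> \<circ> shift x)) (shift ?a \<circ> (\<tau> \<circ> shift x))"
    using two_fold_aut_comp[OF two_fold_aut_shift two_fold_aut_comp[OF s two_fold_aut_shift]] .
  from two_fold_aut_orbit[OF this] have "(\<tau> x - \<sigma> x) mod n \<in> {0, int m}"
    using V sx by (simp add: shift_Z)
  moreover have "(\<tau> x - \<sigma> x) mod n = 0 \<Longrightarrow> \<tau> x = \<sigma> x"
    using Z_eqI[OF V(2,1)] by (simp add: dvd_eq_mod_eq_0)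
  moreover have "n dvd \<tau> x - \<sigma> x - int m" if "(\<tau> x - \<sigma> x) mod n = int m"
    using dvd_mod[of "\<tau> x - \<sigma> x"] unfolding that .
  moreover have "int m \<noteq> 0" using m_gt_0 by simp
  ultimately show ?thesis by (auto simp: half_def)
qed

text \<open>The orbit hypothesis yields an automorphism \<open>h\<close> that keeps both vertices
  over 0 on their sides; by connectedness it comes from a two-fold automorphism.\<close>

lemma ex_two_fold_aut_half: "\<exists>\<sigma> \<tau>. two_fold_aut \<Gamma> \<sigma> \<tau> \<and> \<sigma> 0 = 0 \<and> \<tau> 0 = int m"
proof -
  have "(int m, 1) \<in> {h (0, 1) | h. h \<in> graph_aut (times_K2 \<Gamma>) \<and> h (0, 0) = (0, 0)}"
    unfolding orbit by simp
  then obtain h where h: "h \<in> graph_aut (times_K2 \<Gamma>)" "h (0, 0) = (0, 0)" "h (0, 1) = (int m, 1)" by force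
  have "finite (pverts \<Gamma>)" "0 \<in> pverts \<Gamma>" using m_gt_0 by (simp_all add: pverts_Cay)
  from graph_aut_imp_two_fold_aut[OF h(1) this(1) conn parcs_sub this(2)] h(2,3) show ?thesis
    by (metis fst_conv snd_conv)
qed

text \<open>
  Precomposing with an element fixing 0 on the first side and moving 0 to \<open>m\<close> on the second
  shows that \<open>{x, x + m}\<close> is mapped to such a pair.
\<close>

lemma two_fold_aut_antipode:
  assumes s: "two_fold_aut \<Gamma> \<sigma> \<tau>" and x: "x \<in> Z"
  shows "n dvd \<sigma> ((x + int m) mod n) - \<sigma> x - int m"
proof -
  have p: "\<sigma> permutes Z" "\<tau> permutes Z" using s by (auto simp: two_fold_aut_iff)
  define x' where "x' = (x + int m) mod n"
  have x': "x' \<in> Z" unfolding x'_def by (rule mod_Z)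
  have 0: "0 \<in> Z" and mZ: "int m \<in> Z" using m_gt_0 by simp_all
  obtain k l where k: "two_fold_aut \<Gamma> k l" "k 0 = 0" "l 0 = int m" using ex_two_fold_aut_half by blast
  have "two_fold_aut \<Gamma> (\<sigma> \<circ> shift x \<circ> k) (\<tau> \<circ> shift x \<circ> l)"
    using two_fold_aut_comp[OF two_fold_aut_comp[OF s two_fold_aut_shift] k(1)] .
  from two_fold_aut_half[OF this 0]
  have 1: "n dvd \<tau> x' - \<sigma> x - half (\<tau> x' \<noteq> \<sigma> x)"
    using k x 0 mZ by (simp add: shift_Z x'_def add.commute)
  have 2: "n dvd \<tau> x' - \<sigma> x' - half (\<tau> x' \<noteq> \<sigma> x')" using two_fold_aut_half[OF s x'] by simp
  have "x' \<noteq> x"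
  proof
    assume "x' = x"
    then have "n dvd x + int m - x" using dvd_mod[of "x + int m"] by (simp add: x'_def)
    then show False using m_gt_0 zdvd_imp_le[of n "int m"] by simp
  qed
  then have ne: "\<sigma> x' \<noteq> \<sigma> x" using permutes_inj[OF p(1)] by (simp add: inj_eq)
  have V: "\<sigma> x \<in> Z" "\<sigma> x' \<in> Z" using p x x' by (simp_all only: permutes_in_image)
  \<comment> \<open>Modulo \<open>n\<close>, \<open>\<tau> x'\<close> differs by 0 or
    \<open>m\<close> from each of the distinct points \<open>\<sigma> x\<close> and
    \<open>\<sigma> x'\<close>, so exactly one of the differences is \<open>m\<close>.\<close>
  define a b where "a = (\<tau> x' \<noteq> \<sigma> x')" and "b = (\<tau> x' \<noteq> \<sigma> x)"
  have 3: "n dvd \<sigma> x' - \<sigma> x + half a - half b"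
    using dvd_diff[OF 1 2] by (simp add: a_def b_def algebra_simps)
  have "\<not> n dvd \<sigma> x' - \<sigma> x" using Z_eqI[OF V(2,1)] ne by blast
  with 3 have "a \<noteq> b" by (cases a; cases b) simp_all
  with 3 consider "n dvd \<sigma> x' - \<sigma> x - int m" | "n dvd \<sigma> x' - \<sigma> x + int m"
    by (cases a) (auto simp: half_def)
  then show ?thesis
  proof cases
    case 2
    from dvd_diff[OF this, of n] show ?thesis by (simp add: x'_def algebra_simps)
  qed (simp add: x'_def)
qed

lemma two_fold_lift:
  assumes s: "two_fold_aut \<Gamma> \<sigma> \<tau>"
  shows "two_fold (lift \<sigma>) (\<lambda>x. \<tau> (x mod n) \<noteq> \<sigma> (x mod n))"
  unfolding two_fold_def
proof (intro conjI allI)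
  have p: "\<sigma> permutes Z" "\<tau> permutes Z" using s by (auto simp: two_fold_aut_iff)
  show "lift \<sigma> \<in> Per n" using p(1) by (rule lift_Per)
  fix x
  let ?x = "x mod n"
  define x' where "x' = (x + int m) mod n"
  have x': "x' = (?x + int m) mod n" by (simp add: x'_def mod_add_left_eq)
  have xZ: "?x \<in> Z" "x' \<in> Z" unfolding x'_def by (rule mod_Z)+
  have a: "n dvd \<sigma> x' - \<sigma> ?x - int m" using two_fold_aut_antipode[OF s xZ(1)] x' by simp
  have l: "n dvd \<sigma> (y mod n) - lift \<sigma> y" for y using mod_dvd[of y] by (simp add: lift_def)
  show "n dvd lift \<sigma> (x + int m) - lift \<sigma> x - int m"
    using dvd_diff[OF dvd_add[OF a l[of x]] l[of "x + int m"]] by (simp add: x'_def algebra_simps)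
  \<comment> \<open>Symmetry of the connection set lets the components be exchanged, so
    \<open>\<tau>\<close> commutes with the shift by \<open>m\<close> too; hence the cocycle has
    period \<open>m\<close>.\<close>
  have sw: "two_fold_aut \<Gamma> \<tau> \<sigma>"
    using s S_flip by (simp add: two_fold_aut_iff) metis
  have b: "n dvd \<tau> x' - \<tau> ?x - int m" using two_fold_aut_antipode[OF sw xZ(1)] x' by simp
  have ab: "n dvd (\<tau> x' - \<sigma> x') - (\<tau> ?x - \<sigma> ?x)" using dvd_diff[OF b a] by (simp add: algebra_simps)
  have eq: "\<tau> y = \<sigma> y \<longleftrightarrow> n dvd \<tau> y - \<sigma> y" if "y \<in> Z" for y
    using Z_eqI[of "\<tau> y" "\<sigma> y"] that p by (metis cancel_comm_monoid_add_class.diff_cancel dvd_0_right permutes_in_image)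
  have "(n dvd \<tau> x' - \<sigma> x') = (n dvd \<tau> ?x - \<sigma> ?x)"
    using dvd_add_right_iff[OF ab, of "\<tau> ?x - \<sigma> ?x"] by simp
  then show "(\<tau> ((x + int m) mod n) \<noteq> \<sigma> ((x + int m) mod n)) = (\<tau> ?x \<noteq> \<sigma> ?x)"
    using eq[OF xZ(1)] eq[OF xZ(2)] by (simp add: x'_def)
  fix y
  let ?y = "y mod n"
  have yZ: "?y \<in> Z" by (rule mod_Z)
  have "n dvd (y - x) - (?y - ?x)" using dvd_diff[OF dvd_mod[of y] dvd_mod[of x]] by (simp add: algebra_simps)
  then have "y - x \<in> PS \<longleftrightarrow> ?y - ?x \<in> PS" by (rule S_cong)
  also have "\<dots> \<longleftrightarrow> \<tau> ?y - \<sigma> ?x \<in> PS" using s xZ yZ by (simp add: two_fold_aut_iff)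
  also have "\<dots> \<longleftrightarrow> lift \<sigma> y - lift \<sigma> x + half (\<tau> ?y \<noteq> \<sigma> ?y) \<in> PS"
    by (rule S_cong) (use dvd_diff[OF dvd_add[OF two_fold_aut_half[OF s yZ] l[of y]] l[of x]]
        in \<open>simp add: algebra_simps\<close>)
  finally show "y - x \<in> PS \<longleftrightarrow> lift \<sigma> y - lift \<sigma> x + half (\<tau> ?y \<noteq> \<sigma> ?y) \<in> PS" .
qed

lemma two_fold_proj:
  assumes s: "two_fold \<sigma> w"
  shows "two_fold_aut \<Gamma> (proj \<sigma>) (proj (\<lambda>x. \<sigma> x + half (w x)))"
  unfolding two_fold_aut_iff
proof (intro conjI ballI)
  note sP = two_foldD(1)[OF s]
  show "proj \<sigma> permutes Z" by (rule proj_permutes[OF sP])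
  show "proj (\<lambda>x. \<sigma> x + half (w x)) permutes Z"
  proof (rule inj_imp_permutes)
    show "inj_on (proj (\<lambda>x. \<sigma> x + half (w x))) Z"
    proof (rule inj_onI)
      fix x y assume xy: "x \<in> Z" "y \<in> Z" "proj (\<lambda>x. \<sigma> x + half (w x)) x = proj (\<lambda>x. \<sigma> x + half (w x)) y"
      then have d: "n dvd (\<sigma> x + half (w x)) - (\<sigma> y + half (w y))" by (simp add: proj_def mod_eq_dvd_iff)
      \<comment> \<open>The displacement may be applied before \<open>\<sigma>\<close> instead of
        after it, where injectivity of \<open>\<sigma>\<close> and the period \<open>m\<close> of
        \<open>w\<close> finish the argument.\<close>
      have "n dvd \<sigma> (x + half (w x)) - \<sigma> (y + half (w y))"
        using dvd_add[OF dvd_diff[OF two_fold_half(1)[OF s, of x "w x"] two_fold_half(1)[OF s, of y "w y"]] d]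
        by (simp add: algebra_simps)
      from Per_cong[OF Per_inv[OF sP] this] have e: "n dvd (x + half (w x)) - (y + half (w y))" using sP by simp
      from two_fold_cong[OF s this] have "w x = w y" using two_fold_half(2)[OF s] by simp
      then show "x = y" using Z_eqI[OF xy(1,2)] e by simp
    qed
    show "proj (\<lambda>x. \<sigma> x + half (w x)) ` Z \<subseteq> Z" using mod_Z by (auto simp: proj_def)
  qed (auto simp: proj_def)
  fix x y assume xy: "x \<in> Z" "y \<in> Z"
  have "y - x \<in> PS \<longleftrightarrow> \<sigma> y - \<sigma> x + half (w y) \<in> PS" by (rule two_foldD(4)[OF s])
  also have "\<dots> \<longleftrightarrow> proj (\<lambda>x. \<sigma> x + half (w x)) y - proj \<sigma> x \<in> PS"
    by (rule S_cong) (use dvd_diff[OF dvd_mod[of "\<sigma> y + half (w y)"] dvd_mod[of "\<sigma> x"]] xy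
        in \<open>simp add: proj_def algebra_simps\<close>)
  finally show "y - x \<in> PS \<longleftrightarrow> proj (\<lambda>x. \<sigma> x + half (w x)) y - proj \<sigma> x \<in> PS" .
qed

lemma gamma_eq: "two_fold_aut \<Gamma> \<sigma> \<tau> \<Longrightarrow> gamma \<Gamma> \<sigma> = \<tau>"
  unfolding gamma_def using two_fold_aut_unique[OF red parcs_sub sym_parcs] by blast

text \<open>If \<open>\<tau> y\<close> and \<open>\<sigma> y\<close> differ, then
  \<open>\<tau> y\<close> is the image of \<open>y + m\<close> under \<open>\<sigma>\<close>, so
  \<open>alpha\<close> moves \<open>y\<close> by \<open>m\<close>.\<close>

lemma alpha_displacement:
  assumes s: "two_fold_aut \<Gamma> \<sigma> \<tau>" and y: "y \<in> Z"
  shows "(alpha \<Gamma> \<sigma> y - y) mod n = half (\<tau> y \<noteq> \<sigma> y)"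
proof -
  have p: "\<sigma> permutes Z" "\<tau> permutes Z" using s by (auto simp: two_fold_aut_iff)
  have al: "alpha \<Gamma> \<sigma> y = finv \<sigma> (\<tau> y)" by (simp add: alpha_def gamma_eq[OF s])
  show ?thesis
  proof (cases "\<tau> y = \<sigma> y")
    case True
    then show ?thesis using al permutes_inverses[OF p(1)] by (simp add: half_def)
  next
    case False
    let ?y = "(y + int m) mod n"
    have "n dvd \<tau> y - \<sigma> y - int m" using two_fold_aut_half[OF s y] False by (simp add: half_def)
    from dvd_diff[OF this two_fold_aut_antipode[OF s y]] have "n dvd \<tau> y - \<sigma> ?y" by (simp add: algebra_simps)
    then have "\<tau> y = \<sigma> ?y"
      by (rule Z_eqI[rotated 2]) (use p y mod_Z in \<open>simp_all only: permutes_in_image\<close>)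
    then have "alpha \<Gamma> \<sigma> y = ?y" using al permutes_inverses[OF p(1)] by simp
    then show ?thesis using False m_gt_0 by (simp add: half_def mod_diff_left_eq)
  qed
qed

lemma displacement_eq:
  assumes s: "two_fold_aut \<Gamma> \<sigma> \<tau>" and xy: "x \<in> Z" "y \<in> Z"
  shows "(alpha \<Gamma> \<sigma> x - x) mod n = (alpha \<Gamma> \<sigma> y - y) mod n \<longleftrightarrow> (\<tau> x \<noteq> \<sigma> x) = (\<tau> y \<noteq> \<sigma> y)"
  using alpha_displacement[OF s] xy m_gt_0 by (auto simp: half_def)

text \<open>Displacements of \<open>alpha\<close> are equal exactly when the cocycle values are, and
  \<open>two_fold_lift\<close> and \<open>two_fold_proj\<close> pass between cocycles on residues
  and on the integers.\<close>

lemma B_class_eq: "B_class (2 * m) T = Z \<inter> B"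
proof (rule Set.set_eqI)
  fix y
  have 0: "0 \<in> Z" using m_gt_0 by simp
  have "y \<in> B_class (2 * m) T \<longleftrightarrow> y \<in> Z \<and> (\<forall>\<sigma>\<in>Aut_pi \<Gamma>. (alpha \<Gamma> \<sigma> 0 - 0) mod n = (alpha \<Gamma> \<sigma> y - y) mod n)"
    using 0 by (simp add: B_class_def displacement_rel_def carrier_eq Image_def)
  also have "\<dots> \<longleftrightarrow> y \<in> Z \<and> (\<forall>\<sigma> \<tau>. two_fold_aut \<Gamma> \<sigma> \<tau> \<longrightarrow> (\<tau> 0 \<noteq> \<sigma> 0) = (\<tau> y \<noteq> \<sigma> y))"
    using displacement_eq[OF _ 0, of _ _ y] unfolding Aut_pi_def by blast
  also have "\<dots> \<longleftrightarrow> y \<in> Z \<inter> B"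
  proof (cases "y \<in> Z")
    case y: True
    have "(\<forall>\<sigma> \<tau>. two_fold_aut \<Gamma> \<sigma> \<tau> \<longrightarrow> (\<tau> 0 \<noteq> \<sigma> 0) = (\<tau> y \<noteq> \<sigma> y)) \<longleftrightarrow> y \<in> B"
    proof
      assume h: "\<forall>\<sigma> \<tau>. two_fold_aut \<Gamma> \<sigma> \<tau> \<longrightarrow> (\<tau> 0 \<noteq> \<sigma> 0) = (\<tau> y \<noteq> \<sigma> y)"
      have ne: "proj (\<lambda>x. \<sigma> x + half (w x)) z \<noteq> proj \<sigma> z \<longleftrightarrow> w z" if "z \<in> Z" for \<sigma> w z
      proof -
        have "\<not> n dvd int m" using m_gt_0 zdvd_imp_le[of n "int m"] by auto
        then show ?thesis using that by (auto simp: proj_def half_def mod_eq_dvd_iff)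
      qed
      show "y \<in> B" unfolding B_def
      proof (intro CollectI allI impI)
        fix \<sigma> w assume "two_fold \<sigma> w"
        from h[rule_format, OF two_fold_proj[OF this]] show "w y = w 0" using ne[OF y] ne[OF 0] by simp
      qed
    next
      assume b: "y \<in> B"
      show "\<forall>\<sigma> \<tau>. two_fold_aut \<Gamma> \<sigma> \<tau> \<longrightarrow> (\<tau> 0 \<noteq> \<sigma> 0) = (\<tau> y \<noteq> \<sigma> y)"
      proof (intro allI impI)
        fix \<sigma> \<tau> assume "two_fold_aut \<Gamma> \<sigma> \<tau>"
        from two_fold_lift[OF this] b have "(\<tau> (y mod n) \<noteq> \<sigma> (y mod n)) = (\<tau> (0 mod n) \<noteq> \<sigma> (0 mod n))"
          unfolding B_def by blast
        then show "(\<tau> 0 \<noteq> \<sigma> 0) = (\<tau> y \<noteq> \<sigma> y)" using y by simp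
      qed
    qed
    then show ?thesis using y by simp
  qed blast
  finally show "y \<in> B_class (2 * m) T \<longleftrightarrow> y \<in> Z \<inter> B" .
qed

end

section \<open>Cosets, block systems and the replacement property under the lift\<close>

context half_orbit_circulant
begin

definition rel :: "(int \<Rightarrow> int \<Rightarrow> bool) \<Rightarrow> int rel" where
  "rel E = {(x, y). x \<in> Z \<and> y \<in> Z \<and> E x y}"

abbreviation coset_rel :: "int set \<Rightarrow> int rel" where
  "coset_rel H \<equiv> rel (\<lambda>x y. x - y \<in> H)"

lemma equiv_rel: assumes "equivp E" shows "equiv Z (rel E)"
proof (rule equivI)
  show "rel E \<subseteq> Z \<times> Z" by (auto simp: rel_def)
  show "refl_on Z (rel E)" using equivp_reflp[OF assms] by (auto simp: rel_def refl_on_def)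
  show "sym (rel E)" using equivp_symp[OF assms] by (auto simp: rel_def sym_def)
  show "trans (rel E)" unfolding trans_def rel_def using equivp_transp[OF assms] by blast
qed

lemma equivp_coset: assumes "period_subgroup n H" shows "equivp (\<lambda>x y. x - y \<in> H)"
proof (rule equivpI)
  show "reflp (\<lambda>x y. x - y \<in> H)" using psg_zero[OF assms] by (simp add: reflp_def)
  show "symp (\<lambda>x y. x - y \<in> H)" using psg_flip[OF assms] by (simp add: symp_def)
  show "transp (\<lambda>x y. x - y \<in> H)" using psg_trans[OF assms] by (rule transpI)
qed

lemma r_coset_eq:
  assumes H: "period_subgroup n H" and a: "a \<in> Z"
  shows "(Z \<inter> H) #>\<^bsub>ZMod (2 * m)\<^esub> a = {y \<in> Z. a - y \<in> H}"
proof (intro Set.set_eqI iffI)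
  fix y assume "y \<in> (Z \<inter> H) #>\<^bsub>ZMod (2 * m)\<^esub> a"
  then obtain h where h: "h \<in> H" and y: "y = (h + a) mod n" by (auto simp: r_coset_def)
  have "h - (y - a) \<in> H" by (rule psg_dvd[OF H]) (use dvd_mod[of "h + a"] y in \<open>simp add: algebra_simps\<close>)
  then have "y - a \<in> H" using psg_cong[OF H] h by blast
  then show "y \<in> {y \<in> Z. a - y \<in> H}" using psg_flip[OF H] mod_Z[of "h + a"] y by blast
next
  fix y assume y: "y \<in> {y \<in> Z. a - y \<in> H}"
  have "(y - a) - (y - a) mod n \<in> H" by (rule psg_dvd[OF H dvd_mod])
  then have "(y - a) mod n \<in> H" using psg_cong[OF H] psg_flip[OF H] y by blast
  then have "(y - a) mod n \<in> Z \<inter> H" using mod_Z by blast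
  moreover have "y = ((y - a) mod n + a) mod n" using y by (simp add: mod_add_left_eq)
  ultimately show "y \<in> (Z \<inter> H) #>\<^bsub>ZMod (2 * m)\<^esub> a" by (auto simp: r_coset_def)
qed

lemma rcosets_eq:
  assumes H: "period_subgroup n H"
  shows "rcosets\<^bsub>ZMod (2 * m)\<^esub> (Z \<inter> H) = Z // coset_rel H"
proof -
  have "coset_rel H `` {a} = (Z \<inter> H) #>\<^bsub>ZMod (2 * m)\<^esub> a" if "a \<in> Z" for a
    using r_coset_eq[OF H that] that by (auto simp: rel_def)
  then show ?thesis by (auto simp: RCOSETS_def quotient_def carrier_eq)
qed

lemma subgroup_lift:
  assumes H: "subgroup H (ZMod (2 * m))"
  shows "period_subgroup n {x. x mod n \<in> H}" and "H = Z \<inter> {x. x mod n \<in> H}"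
proof -
  interpret subgroup H "ZMod (2 * m)" by (rule H)
  have sub: "H \<subseteq> Z" using subset carrier_eq by simp
  then show "H = Z \<inter> {x. x mod n \<in> H}" by auto
  have "(a - b) mod n \<in> H" if "a mod n \<in> H" "b mod n \<in> H" for a b
  proof -
    have "inv\<^bsub>ZMod (2 * m)\<^esub> (b mod n) = (- b) mod n"
      using that sub carrier_eq by (subst inv_integer_mod_group) (auto simp: mod_minus_eq)
    then have "(- b) mod n \<in> H" using m_inv_closed[OF that(2)] by simp
    from m_closed[OF that(1) this] show ?thesis by (simp add: mod_add_eq)
  qed
  then show "period_subgroup n {x. x mod n \<in> H}" using one_closed by (simp add: period_subgroup_def)
qed

lemma coset_rel_mod:
  assumes H: "period_subgroup n H" shows "x mod n - y mod n \<in> H \<longleftrightarrow> x - y \<in> H"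
proof (rule psg_cong[OF H psg_dvd[OF H]])
  show "n dvd (x mod n - y mod n) - (x - y)"
    using dvd_diff[OF mod_dvd[of x] mod_dvd[of y]] by (simp add: algebra_simps)
qed

lemma proj_mod: "proj \<sigma> (x mod n) = \<sigma> (x mod n) mod n"
  using mod_Z by (simp add: proj_def)

lemma Aut_pi_lift: "\<sigma> \<in> Aut_pi \<Gamma> \<Longrightarrow> \<exists>w. two_fold (lift \<sigma>) w"
  using two_fold_lift by (auto simp: Aut_pi_def)

lemma Aut_pi_proj: "two_fold \<sigma> w \<Longrightarrow> proj \<sigma> \<in> Aut_pi \<Gamma>"
  using two_fold_proj by (auto simp: Aut_pi_def)

lemma Aut_pi_permutes: "\<sigma> \<in> Aut_pi \<Gamma> \<Longrightarrow> \<sigma> permutes Z"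
  by (auto simp: Aut_pi_def two_fold_aut_iff)

lemma block_system_two_fold:
  assumes H: "period_subgroup n H" and bs: "block_system Z (Aut_pi \<Gamma>) (Z // coset_rel H)"
    and s: "two_fold \<sigma> w" and xy: "x - y \<in> H"
  shows "\<sigma> x - \<sigma> y \<in> H"
proof -
  note eq = equiv_rel[OF equivp_coset[OF H]] and sP = two_foldD(1)[OF s]
  let ?X = "coset_rel H `` {x mod n}"
  have "?X \<in> Z // coset_rel H" using mod_Z by (rule quotientI)
  then have im: "proj \<sigma> ` ?X \<in> Z // coset_rel H"
    using bs Aut_pi_proj[OF s] by (auto simp: block_system_def bij_betw_def)
  have X: "x mod n \<in> ?X" "y mod n \<in> ?X"
    using mod_Z coset_rel_mod[OF H] xy psg_zero[OF H] by (auto simp: rel_def)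
  have "(proj \<sigma> (x mod n), proj \<sigma> (y mod n)) \<in> coset_rel H"
    using quotient_eq_iff[OF eq im im imageI[OF X(1)] imageI[OF X(2)]] by simp
  then have "\<sigma> (x mod n) mod n - \<sigma> (y mod n) mod n \<in> H"
    by (simp add: rel_def proj_mod)
  then have "\<sigma> (x mod n) - \<sigma> (y mod n) \<in> H" using coset_rel_mod[OF H] by blast
  moreover have "(\<sigma> (x mod n) - \<sigma> (y mod n)) - (\<sigma> x - \<sigma> y) \<in> H"
    by (rule psg_dvd[OF H])
      (use dvd_diff[OF Per_cong[OF sP mod_dvd[of x]] Per_cong[OF sP mod_dvd[of y]]] in \<open>simp add: algebra_simps\<close>)
  ultimately show ?thesis using psg_cong[OF H] by blast
qed

lemma block_system_quotient:
  assumes E: "equivp E" and inv: "\<And>\<sigma> w x y. two_fold \<sigma> w \<Longrightarrow> E x y \<Longrightarrow> E (\<sigma> x) (\<sigma> y)"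
  shows "block_system Z (Aut_pi \<Gamma>) (Z // rel E)"
  unfolding block_system_def
proof (intro conjI ballI)
  note eq = equiv_rel[OF E]
  show "partition_on Z (Z // rel E)" using partition_on_quotient[OF eq] .
  fix \<sigma> assume s: "\<sigma> \<in> Aut_pi \<Gamma>"
  obtain w where t: "two_fold (lift \<sigma>) w" using Aut_pi_lift[OF s] by blast
  note p = Aut_pi_permutes[OF s]
  \<comment> \<open>The converse direction is invariance under the inverse of the lift.\<close>
  have E_iff: "E (\<sigma> x) (\<sigma> y) \<longleftrightarrow> E x y" if "x \<in> Z" "y \<in> Z" for x y
    using inv[OF t, of x y] inv[OF two_fold_inv[OF t], of "lift \<sigma> x" "lift \<sigma> y"] that lift_Per[OF p]
    by (auto simp: lift_Z)
  have im: "\<sigma> ` (rel E `` {x}) = rel E `` {\<sigma> x}" if x: "x \<in> Z" for x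
  proof (intro Set.set_eqI iffI)
    fix z assume "z \<in> \<sigma> ` (rel E `` {x})"
    then obtain y where "y \<in> Z" "E x y" "z = \<sigma> y" by (auto simp: rel_def)
    then show "z \<in> rel E `` {\<sigma> x}" using x E_iff permutes_in_image[OF p] by (simp add: rel_def)
  next
    fix z assume "z \<in> rel E `` {\<sigma> x}"
    then have z: "z \<in> Z" "E (\<sigma> x) z" by (auto simp: rel_def)
    have *: "\<sigma> (finv \<sigma> z) = z" using permutes_inverses[OF p] by simp
    then have "finv \<sigma> z \<in> Z" using permutes_in_image[OF p, of "finv \<sigma> z"] z(1) by simp
    moreover from this have "E x (finv \<sigma> z)" using E_iff[OF x, of "finv \<sigma> z"] z(2) * by simp
    ultimately show "z \<in> \<sigma> ` (rel E `` {x})" using x * by (intro image_eqI[of _ _ "finv \<sigma> z"]) (simp_all add: rel_def)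
  qed
  show "bij_betw ((`) \<sigma>) (Z // rel E) (Z // rel E)"
  proof (rule bij_betw_imageI)
    show "inj_on ((`) \<sigma>) (Z // rel E)"
      using inj_image_eq_iff[OF permutes_inj[OF p]] by (auto intro: inj_onI)
    have Q: "Z // rel E = (\<lambda>x. rel E `` {x}) ` Z" by (auto simp: quotient_def)
    have "(`) \<sigma> ` (Z // rel E) = (\<lambda>x. \<sigma> ` (rel E `` {x})) ` Z" unfolding Q image_image ..
    also have "\<dots> = (\<lambda>x. rel E `` {\<sigma> x}) ` Z" by (rule image_cong[OF refl im])
    also have "\<dots> = (\<lambda>x. rel E `` {x}) ` \<sigma> ` Z" unfolding image_image ..
    also have "\<dots> = Z // rel E" unfolding permutes_image[OF p] Q ..
    finally show "(`) \<sigma> ` (Z // rel E) = Z // rel E" .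
  qed
qed

lemma reflective_set_eq: "s mod n \<in> reflective_set (2 * m) m T \<longleftrightarrow> s \<in> Sr"
proof -
  have "u \<in> PS \<longleftrightarrow> u mod n \<in> T" for u by (simp add: PS_def)
  then show ?thesis by (simp add: reflective_set_def Sr_def mod_add_left_eq)
qed

lemma graph_aut_reflective_iff:
  "\<sigma> \<in> graph_aut (Cay (2 * m) (reflective_set (2 * m) m T)) \<longleftrightarrow>
     \<sigma> permutes Z \<and> (\<forall>x\<in>Z. \<forall>y\<in>Z. y - x \<in> Sr \<longleftrightarrow> \<sigma> y - \<sigma> x \<in> Sr)"
proof -
  have "((x, y) \<in> parcs (Cay (2 * m) (reflective_set (2 * m) m T)) \<longleftrightarrow>
      (\<sigma> x, \<sigma> y) \<in> parcs (Cay (2 * m) (reflective_set (2 * m) m T))) \<longleftrightarrow>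
      (y - x \<in> Sr \<longleftrightarrow> \<sigma> y - \<sigma> x \<in> Sr)" if "\<sigma> permutes Z" "x \<in> Z" "y \<in> Z" for x y
    using that permutes_in_image[OF that(1)] by (simp add: parcs_Cay reflective_set_eq)
  then show ?thesis unfolding graph_aut_def pverts_Cay by blast
qed

lemma coset_fixing_lift:
  assumes H: "period_subgroup n H"
    and s: "\<sigma> \<in> coset_fixing_aut (2 * m) (reflective_set (2 * m) m T) (Z \<inter> H)"
  shows "lift \<sigma> \<in> CF H"
proof -
  from s have p: "\<sigma> permutes Z" and e: "\<And>x y. x \<in> Z \<Longrightarrow> y \<in> Z \<Longrightarrow> y - x \<in> Sr \<longleftrightarrow> \<sigma> y - \<sigma> x \<in> Sr"
    and fx: "\<And>h. h \<in> Z // coset_rel H \<Longrightarrow> \<sigma> ` h = h"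
    by (auto simp: coset_fixing_aut_def graph_aut_reflective_iff rcosets_eq[OF H])
  have "lift \<sigma> x - x \<in> H" for x
  proof -
    have "\<sigma> ` (coset_rel H `` {x mod n}) = coset_rel H `` {x mod n}" by (rule fx[OF quotientI[OF mod_Z]])
    moreover have "x mod n \<in> coset_rel H `` {x mod n}" using mod_Z psg_zero[OF H] by (simp add: rel_def)
    ultimately have "\<sigma> (x mod n) \<in> coset_rel H `` {x mod n}" by blast
    then have "x mod n - \<sigma> (x mod n) \<in> H" by (simp add: rel_def)
    then show ?thesis using psg_flip[OF H] by (simp add: lift_def algebra_simps)
  qed
  moreover have "y - x \<in> Sr \<longleftrightarrow> lift \<sigma> y - lift \<sigma> x \<in> Sr" for x y
  proof -
    have d: "n dvd (y - x) - (y mod n - x mod n)"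
      using dvd_diff[OF dvd_mod[of y] dvd_mod[of x]] by (simp add: algebra_simps)
    then have "y - x \<in> Sr \<longleftrightarrow> y mod n - x mod n \<in> Sr" by (rule Sr_cong)
    also have "\<dots> \<longleftrightarrow> \<sigma> (y mod n) - \<sigma> (x mod n) \<in> Sr" using e mod_Z by blast
    also have "\<dots> \<longleftrightarrow> lift \<sigma> y - lift \<sigma> x \<in> Sr"
      using Sr_cong[of "lift \<sigma> y - lift \<sigma> x" "\<sigma> (y mod n) - \<sigma> (x mod n)"] d
      by (simp add: lift_def algebra_simps)
    finally show ?thesis .
  qed
  ultimately show ?thesis using lift_Per[OF p] by (simp add: CF_def)
qed

lemma coset_fixing_proj:
  assumes H: "period_subgroup n H" and s: "\<sigma> \<in> CF H"
  shows "proj \<sigma> \<in> coset_fixing_aut (2 * m) (reflective_set (2 * m) m T) (Z \<inter> H)"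
proof -
  note p = proj_permutes[OF CFD(1)[OF s]]
  have "y - x \<in> Sr \<longleftrightarrow> proj \<sigma> y - proj \<sigma> x \<in> Sr" if "x \<in> Z" "y \<in> Z" for x y
  proof -
    have "\<sigma> y - \<sigma> x \<in> Sr \<longleftrightarrow> proj \<sigma> y - proj \<sigma> x \<in> Sr"
      by (rule Sr_cong) (use dvd_diff[OF dvd_mod[of "\<sigma> y"] dvd_mod[of "\<sigma> x"]] that in
          \<open>simp add: proj_def algebra_simps\<close>)
    then show ?thesis using CFD(3)[OF s] by simp
  qed
  moreover have "proj \<sigma> ` h = h" if "h \<in> Z // coset_rel H" for h
  proof -
    from that obtain x where x: "x \<in> Z" and h: "h = coset_rel H `` {x}" by (rule quotientE)
    have hZ: "h \<subseteq> Z" by (auto simp: h rel_def)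
    \<comment> \<open>One inclusion suffices, since the coset is finite and the map
      injective.\<close>
    have "proj \<sigma> ` h \<subseteq> h"
    proof
      fix z assume "z \<in> proj \<sigma> ` h"
      then obtain y where y: "y \<in> Z" "x - y \<in> H" "z = \<sigma> y mod n" by (auto simp: h rel_def proj_def)
      have "\<sigma> y - z \<in> H" using psg_dvd[OF H dvd_mod] y(3) by simp
      then have "y - z \<in> H" using psg_trans[OF H, of y "\<sigma> y" z] CFD(2)[OF s, of y] psg_flip[OF H] by blast
      then have "x - z \<in> H" using psg_trans[OF H y(2)] by blast
      then show "z \<in> h" using x y(3) mod_Z[of "\<sigma> y"] by (simp add: h rel_def)
    qed
    then show ?thesis
      using endo_inj_surj[of h "proj \<sigma>"] finite_subset[OF hZ] permutes_inj_on[OF p] by simp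
  qed
  ultimately show ?thesis using p
    by (simp add: coset_fixing_aut_def graph_aut_reflective_iff rcosets_eq[OF H])
qed

lemma replaces_lift:
  assumes H: "period_subgroup n H"
    and rp: "replacement_property (2 * m) (reflective_set (2 * m) m T) (Z \<inter> H)"
  shows "\<exists>f. replaces H f"
proof -
  let ?R = "Z // coset_rel H" and ?A = "coset_fixing_aut (2 * m) (reflective_set (2 * m) m T) (Z \<inter> H)"
  obtain f where f: "\<And>h. h \<in> ?R \<Longrightarrow> f h \<in> h" "f (Z \<inter> H) = 0"
    and ex: "\<And>\<sigma>. \<sigma> \<in> ?A \<Longrightarrow> \<exists>\<sigma>'\<in>?A. \<forall>h\<in>?R. \<forall>x\<in>h. \<sigma>' x = (\<sigma> ((x - f h) mod n) + f h) mod n"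
    using rp unfolding replacement_property_def rcosets_eq[OF H] by auto
  define c where "c x = coset_rel H `` {x mod n}" for x
  have cR: "c x \<in> ?R" for x unfolding c_def using mod_Z by (rule quotientI)
  have c_eq: "c x = c y" if "x - y \<in> H" for x y
  proof -
    have "(x mod n, y mod n) \<in> coset_rel H" using that coset_rel_mod[OF H] mod_Z by (simp add: rel_def)
    then show ?thesis unfolding c_def by (rule equiv_class_eq[OF equiv_rel[OF equivp_coset[OF H]]])
  qed
  have "c 0 = Z \<inter> H" using m_gt_0 psg_uminus_iff[OF H] by (auto simp: c_def rel_def)
  then have c0: "f (c x) = 0" if "x \<in> H" for x using c_eq[of x 0] that f(2) by simp
  define g where "g x = f (c x)" for x
  have gx: "g x - x \<in> H" for x
  proof -
    have "g x \<in> c x" unfolding g_def by (rule f(1)[OF cR])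
    then have "x mod n - g x \<in> H" by (simp add: c_def rel_def)
    moreover have "x - x mod n \<in> H" by (rule psg_dvd[OF H dvd_mod])
    ultimately have "x - g x \<in> H" using psg_trans[OF H] by blast
    then show ?thesis using psg_flip[OF H] by blast
  qed
  have "(\<lambda>x. \<sigma> (x - g x) + g x) \<in> CF H" if s: "\<sigma> \<in> CF H" for \<sigma>
  proof -
    note sP = CFD(1)[OF s]
    obtain \<sigma>' where s': "\<sigma>' \<in> ?A"
      and eq: "\<And>h x. h \<in> ?R \<Longrightarrow> x \<in> h \<Longrightarrow> \<sigma>' x = (proj \<sigma> ((x - f h) mod n) + f h) mod n"
      using ex[OF coset_fixing_proj[OF H s]] by blast
    define \<rho> where "\<rho> x = \<sigma> (x - g x) + g x" for x
    note l = coset_fixing_lift[OF H s']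
    have gn: "g x = g y" if "x - y \<in> H" for x y using c_eq[OF that] by (simp add: g_def)
    \<comment> \<open>On residues the replaced map is known only modulo \<open>n\<close>. Congruence
      to the bijection \<open>lift \<sigma>'\<close>, together with commuting with the shift by
      \<open>n\<close>, makes \<open>\<rho>\<close> bijective.\<close>
    have near: "n dvd lift \<sigma>' x - \<rho> x" for x
    proof -
      let ?x = "x mod n"
      have xc: "?x \<in> c x" using mod_Z psg_zero[OF H] by (simp add: c_def rel_def)
      have "\<sigma>' ?x = (\<sigma> ((?x - g x) mod n) mod n + g x) mod n"
        using eq[OF cR xc] mod_Z[of "?x - g x"] by (simp add: g_def proj_def)
      then have 1: "n dvd \<sigma>' ?x - (\<sigma> ((?x - g x) mod n) + g x)"
        by (simp add: mod_eq_dvd_iff[symmetric] mod_add_left_eq)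
      have 2: "n dvd \<sigma> ((?x - g x) mod n) - \<sigma> (?x - g x)" by (rule Per_cong[OF sP mod_dvd])
      have 3: "\<sigma> (?x - g x) - \<sigma> (x - g x) = ?x - x"
        using Per_diff[OF sP, of "?x - g x" "x - g x"] mod_dvd[of x] by simp
      have "lift \<sigma>' x - \<rho> x = \<sigma>' ?x - (\<sigma> (?x - g x) + g x)" using 3 by (simp add: lift_def \<rho>_def)
      moreover have "n dvd \<sigma>' ?x - (\<sigma> (?x - g x) + g x)" using dvd_add[OF 1 2] by (simp add: algebra_simps)
      ultimately show ?thesis by (simp only:)
    qed
    have per: "\<rho> (x + n) = \<rho> x + n" for x
    proof -
      have "g (x + n) = g x" by (rule gn) (simp add: psg_period[OF H, simplified])
      then show ?thesis using Per_shift[OF sP, of "x - g x" 1] by (simp add: \<rho>_def algebra_simps)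
    qed
    define \<delta> where "\<delta> x = \<rho> x - lift \<sigma>' x" for x
    have "bij \<rho>"
    proof (rule bijI)
      show "inj \<rho>"
      proof (rule injI)
        fix x y assume xy: "\<rho> x = \<rho> y"
        have "n dvd lift \<sigma>' x - lift \<sigma>' y" using dvd_diff[OF near[of x] near[of y]] xy by simp
        from Per_cong[OF Per_inv[OF CFD(1)[OF l]] this] have "n dvd x - y" using CFD(1)[OF l] by simp
        then obtain k where k: "x = y + k * n" by (rule dvd_diff_imp_shift)
        have "\<rho> x - x = \<rho> y - y" unfolding k by (rule periodic_int) (simp add: per)
        then show "x = y" using xy by simp
      qed
      show "surj \<rho>"
      proof (rule surjI)
        fix z
        let ?u = "finv (lift \<sigma>') z"
        have "n dvd lift \<sigma>' ?u - \<rho> ?u" by (rule near)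
        then obtain k where k: "z = \<rho> ?u + k * n"
          unfolding Per_inv_right[OF CFD(1)[OF l]] by (rule dvd_diff_imp_shift)
        have "\<rho> (?u + k * n) - (?u + k * n) = \<rho> ?u - ?u"
          by (rule periodic_int) (simp add: per)
        then have "\<rho> (?u + k * n) = \<rho> ?u + k * n" by simp
        moreover have "z - \<rho> ?u = k * n" using k by (simp only: add_diff_cancel_left')
        ultimately show "\<rho> (?u + (z - \<rho> ?u)) = z" using k by (simp only:)
      qed
    qed
    then have "\<rho> \<in> Per n" using per by (simp add: Per_def)
    moreover have "\<rho> x - x \<in> H" for x
      using CFD(2)[OF s, of "x - g x"] by (simp add: \<rho>_def algebra_simps)
    moreover have "y - x \<in> Sr \<longleftrightarrow> \<rho> y - \<rho> x \<in> Sr" for x y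
    proof -
      have "lift \<sigma>' y - lift \<sigma>' x \<in> Sr \<longleftrightarrow> \<rho> y - \<rho> x \<in> Sr"
        by (rule Sr_cong) (use dvd_diff[OF near[of y] near[of x]] in \<open>simp add: algebra_simps\<close>)
      then show ?thesis using CFD(3)[OF l, of y x] by simp
    qed
    ultimately show ?thesis unfolding \<rho>_def[symmetric] by (simp add: CF_def)
  qed
  moreover have "g x = g y" if "x - y \<in> H" for x y using c_eq[OF that] by (simp add: g_def)
  ultimately have "replaces H g" using gx c0 by (simp add: replaces_def g_def)
  then show ?thesis by blast
qed

lemma iso_if_twisted_permutation:
  assumes p: "\<phi> \<in> Per n" and tw: "\<And>x y. y - x \<in> PS \<longleftrightarrow> \<phi> y - \<phi> x + int m \<in> PS"
  shows "digraph_iso (with_proj \<Gamma>) (with_proj (Cay (2 * m) ((\<lambda>s. (s + int m) mod int (2 * m)) ` T)))"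
proof -
  let ?T = "(\<lambda>s. (s + int m) mod int (2 * m)) ` T"
  define \<psi> where "\<psi> = proj \<phi>"
  have psi: "\<psi> permutes Z" unfolding \<psi>_def by (rule proj_permutes[OF p])
  \<comment> \<open>Adding \<open>m\<close> twice is trivial modulo \<open>n\<close>, so adding
    \<open>m\<close> once more undoes the translation of \<open>T\<close>.\<close>
  have T_iff: "s mod n \<in> ?T \<longleftrightarrow> s + int m \<in> PS" for s
  proof
    assume "s mod n \<in> ?T"
    then obtain t where t: "t \<in> T" "s mod n = (t + int m) mod n" by auto
    then have "(s + int m) mod n = (t + int m + int m) mod n" by (metis mod_add_left_eq)
    also have "\<dots> = t" using T_sub t(1) carrier_eq by (auto simp: add.assoc)
    finally show "s + int m \<in> PS" using t(1) by (simp add: PS_def)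
  next
    assume "s + int m \<in> PS"
    then have "(s + int m) mod n \<in> T" by (simp add: PS_def)
    moreover have "s mod n = ((s + int m) mod n + int m) mod int (2 * m)"
      by (simp add: mod_add_left_eq add.assoc)
    ultimately show "s mod n \<in> ?T" by blast
  qed
  have edge: "(\<psi> x, \<psi> y) \<in> parcs (Cay (2 * m) ?T) \<longleftrightarrow> (x, y) \<in> parcs \<Gamma>" if xy: "x \<in> Z" "y \<in> Z" for x y
  proof -
    have "n dvd (\<psi> y - \<psi> x + int m) - (\<phi> y - \<phi> x + int m)"
      using dvd_diff[OF mod_dvd[of "\<phi> y"] mod_dvd[of "\<phi> x"]] xy by (simp add: \<psi>_def proj_def algebra_simps)
    then have "\<psi> y - \<psi> x + int m \<in> PS \<longleftrightarrow> y - x \<in> PS" using S_cong tw by blast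
    then show ?thesis using xy permutes_in_image[OF psi] T_iff
      unfolding parcs_Cay[of _ _ ?T] parcs_Gamma by blast
  qed
  let ?f = "\<lparr>iso_verts = \<psi>, iso_arcs = map_prod \<psi> \<psi>, iso_head = snd, iso_tail = fst\<rparr>"
  have inj: "inj (map_prod \<psi> \<psi>)" using prod.inj_map[OF permutes_inj[OF psi] permutes_inj[OF psi]] .
  have "wf_digraph (with_proj \<Gamma>)" using parcs_sub by unfold_locales auto
  then have "pre_digraph.digraph_isomorphism (with_proj \<Gamma>) ?f"
    using permutes_inj_on[OF psi] inj_on_subset[OF inj]
    by (simp add: pre_digraph.digraph_isomorphism_def)
  moreover have "parcs (Cay (2 * m) ?T) = map_prod \<psi> \<psi> ` parcs \<Gamma>"
  proof (intro Set.set_eqI iffI)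
    fix e assume e: "e \<in> parcs (Cay (2 * m) ?T)"
    obtain u v where uv: "e = (u, v)" by force
    then have "u \<in> \<psi> ` Z" "v \<in> \<psi> ` Z" using e unfolding permutes_image[OF psi] by (simp_all add: parcs_Cay)
    then obtain x y where xy: "x \<in> Z" "u = \<psi> x" "y \<in> Z" "v = \<psi> y" by (elim imageE)
    then have "(x, y) \<in> parcs \<Gamma>" using e edge uv by simp
    then show "e \<in> map_prod \<psi> \<psi> ` parcs \<Gamma>" using uv xy by (intro image_eqI[of _ _ "(x, y)"]) simp_all
  next
    fix e assume "e \<in> map_prod \<psi> \<psi> ` parcs \<Gamma>"
    then obtain x y where "(x, y) \<in> parcs \<Gamma>" "e = (\<psi> x, \<psi> y)" by auto
    then show "e \<in> parcs (Cay (2 * m) ?T)" using edge[of x y] by (simp add: parcs_Gamma)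
  qed
  then have "with_proj (Cay (2 * m) ?T) = app_iso ?f (with_proj \<Gamma>)"
    using permutes_image[OF psi] by (simp add: with_proj_def app_iso_def pverts_Cay)
  ultimately show ?thesis unfolding digraph_iso_def by blast
qed

theorem digraph_iso_translate:
  assumes Bt: "subgroup Bt (ZMod (2 * m))"
    and bs: "block_system (carrier (ZMod (2 * m))) (Aut_pi \<Gamma>) (rcosets\<^bsub>ZMod (2 * m)\<^esub> Bt)"
    and ref: "refines (carrier (ZMod (2 * m))) (rcosets\<^bsub>ZMod (2 * m)\<^esub> (B_class (2 * m) T)) (rcosets\<^bsub>ZMod (2 * m)\<^esub> Bt)"
    and ne: "rcosets\<^bsub>ZMod (2 * m)\<^esub> (B_class (2 * m) T) \<noteq> rcosets\<^bsub>ZMod (2 * m)\<^esub> Bt"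
    and min: "\<And>P. block_system (carrier (ZMod (2 * m))) (Aut_pi \<Gamma>) P \<Longrightarrow>
           refines (carrier (ZMod (2 * m))) (rcosets\<^bsub>ZMod (2 * m)\<^esub> (B_class (2 * m) T)) P \<Longrightarrow>
           rcosets\<^bsub>ZMod (2 * m)\<^esub> (B_class (2 * m) T) \<noteq> P \<Longrightarrow>
           refines (carrier (ZMod (2 * m))) P (rcosets\<^bsub>ZMod (2 * m)\<^esub> Bt) \<Longrightarrow>
           P = rcosets\<^bsub>ZMod (2 * m)\<^esub> Bt"
    and rpB: "replacement_property (2 * m) (reflective_set (2 * m) m T) (B_class (2 * m) T)"
    and rpBt: "replacement_property (2 * m) (reflective_set (2 * m) m T) Bt"
  shows "digraph_iso (with_proj \<Gamma>) (with_proj (Cay (2 * m) ((\<lambda>s. (s + int m) mod int (2 * m)) ` T)))"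
proof -
  define H where "H = {x. x mod n \<in> Bt}"
  have H: "period_subgroup n H" "Bt = Z \<inter> H" unfolding H_def by (rule subgroup_lift[OF Bt])+
  have RB: "rcosets\<^bsub>ZMod (2 * m)\<^esub> (B_class (2 * m) T) = Z // coset_rel B"
    unfolding B_class_eq by (rule rcosets_eq[OF B_psg])
  have RH: "rcosets\<^bsub>ZMod (2 * m)\<^esub> Bt = Z // coset_rel H" unfolding H(2) by (rule rcosets_eq[OF H(1)])
  note eB = equiv_rel[OF equivp_coset[OF B_psg]] and eH = equiv_rel[OF equivp_coset[OF H(1)]]
  have rel_mono: "rel E \<subseteq> rel E'" if "\<And>x y. E x y \<Longrightarrow> E' x y" for E E' using that by (auto simp: rel_def)
  have sub: "coset_rel B \<subseteq> coset_rel H"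
    using refines_quotient_imp_subset[OF eB eH] ref unfolding RB RH carrier_eq by blast
  have BH: "B \<subseteq> H"
  proof
    fix b assume "b \<in> B"
    then have "(b mod n, 0 mod n) \<in> coset_rel B" using coset_rel_mod[OF B_psg, of b 0] mod_Z[of b] mod_Z[of 0]
      by (simp add: rel_def)
    then have "(b mod n, 0 mod n) \<in> coset_rel H" using sub by blast
    then show "b \<in> H" using coset_rel_mod[OF H(1), of b 0] by (simp add: rel_def)
  qed
  moreover have "B \<noteq> H" using ne unfolding RB RH by blast
  ultimately have BH': "B \<subset> H" by blast
  obtain f where f: "replaces B f" using replaces_lift[OF B_psg] rpB unfolding B_class_eq by blast
  obtain g where g: "replaces H g" using replaces_lift[OF H(1)] rpBt H(2) by metis
  interpret replacement "int m" PS H f g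
  proof unfold_locales
    show "period_subgroup n H" "B \<subset> H" "replaces B f" "replaces H g" by fact+
    show "\<sigma> x - \<sigma> y \<in> H" if "two_fold \<sigma> w" "x - y \<in> H" for \<sigma> w x y
      using block_system_two_fold[OF H(1)] bs that unfolding RH carrier_eq by blast
    fix E x y x' y'
    assume E: "equivp E" and BE: "\<And>x y. x - y \<in> B \<Longrightarrow> E x y" and EH: "\<And>x y. E x y \<Longrightarrow> x - y \<in> H"
      and inv: "\<And>\<sigma> w x y. two_fold \<sigma> w \<Longrightarrow> E x y \<Longrightarrow> E (\<sigma> x) (\<sigma> y)"
      and xy: "E x y" "x - y \<notin> B" and xy': "x' - y' \<in> H"
    note eE = equiv_rel[OF E]
    \<comment> \<open>Multiples of \<open>n\<close> lie in \<open>B\<close>, so \<open>E\<close> is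
      determined by its restriction to residues, where minimality among partitions applies.\<close>
    have E_mod: "E (u mod n) (v mod n) \<longleftrightarrow> E u v" for u v
    proof -
      have "E (u mod n) u" "E (v mod n) v" using BE[OF psg_dvd[OF B_psg mod_dvd]] by blast+
      then show ?thesis using E by (metis equivp_symp equivp_transp)
    qed
    have "Z // rel E = rcosets\<^bsub>ZMod (2 * m)\<^esub> Bt"
    proof (rule min; unfold carrier_eq RB RH)
      show "block_system Z (Aut_pi \<Gamma>) (Z // rel E)" by (rule block_system_quotient[OF E]) (rule inv)
      show "refines Z (Z // coset_rel B) (Z // rel E)" by (rule refines_quotient[OF eB eE rel_mono[OF BE]])
      show "refines Z (Z // rel E) (Z // coset_rel H)" by (rule refines_quotient[OF eE eH rel_mono[OF EH]])
      show "Z // coset_rel B \<noteq> Z // rel E"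
      proof
        assume "Z // coset_rel B = Z // rel E"
        then have "coset_rel B = rel E" by (rule quotient_eq_imp_eq[OF eB eE])
        moreover have "(x mod n, y mod n) \<in> rel E" using E_mod xy mod_Z[of x] mod_Z[of y] by (simp add: rel_def)
        ultimately have "x mod n - y mod n \<in> B" by (auto simp: rel_def)
        then show False using coset_rel_mod[OF B_psg] xy(2) by blast
      qed
    qed
    then have "rel E = coset_rel H" unfolding RH by (rule quotient_eq_imp_eq[OF eE eH])
    moreover have "(x' mod n, y' mod n) \<in> coset_rel H"
      using coset_rel_mod[OF H(1)] xy' mod_Z[of x'] mod_Z[of y'] by (simp add: rel_def)
    ultimately have "(x' mod n, y' mod n) \<in> rel E" by simp
    then have "E (x' mod n) (y' mod n)" by (simp add: rel_def)
    then show "E x' y'" using E_mod by blast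
  qed
  show ?thesis using ex_twisted_permutation iso_if_twisted_permutation by blast
qed

end

theorem theorem6p1:
  fixes n m :: nat and S B Bt :: "int set"
  assumes "n = 2 * m" and "m > 1" and "odd m"
    and "S \<subseteq> carrier (ZMod n)" and "(\<lambda>s. (- s) mod int n) ` S = S" and "0 \<notin> S"
    and "Digraph_Component.connected (with_proj (Cay n S))"
    and "\<not> bipartite (Cay n S)"
    and "reduced (Cay n S)"
    and "unstable (Cay n S)"
    and "{h (0, 1) | h. h \<in> graph_aut (times_K2 (Cay n S)) \<and> h (0, 0) = (0, 0)}
           = {(0, 1), (int m, 1)}"
    and "B = B_class n S"
    and "subgroup Bt (ZMod n)"
    and "block_system (carrier (ZMod n)) (Aut_pi (Cay n S)) (rcosets\<^bsub>ZMod n\<^esub> Bt)"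
    and "refines (carrier (ZMod n)) (rcosets\<^bsub>ZMod n\<^esub> B) (rcosets\<^bsub>ZMod n\<^esub> Bt)"
    and "rcosets\<^bsub>ZMod n\<^esub> B \<noteq> rcosets\<^bsub>ZMod n\<^esub> Bt"
    and "\<And>P. block_system (carrier (ZMod n)) (Aut_pi (Cay n S)) P \<Longrightarrow>
           refines (carrier (ZMod n)) (rcosets\<^bsub>ZMod n\<^esub> B) P \<Longrightarrow>
           rcosets\<^bsub>ZMod n\<^esub> B \<noteq> P \<Longrightarrow>
           refines (carrier (ZMod n)) P (rcosets\<^bsub>ZMod n\<^esub> Bt) \<Longrightarrow>
           P = rcosets\<^bsub>ZMod n\<^esub> Bt"
    and "replacement_property n (reflective_set n m S) B"
    and "replacement_property n (reflective_set n m S) Bt"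
  shows "digraph_iso (with_proj (Cay n S))
           (with_proj (Cay n ((\<lambda>s. (s + int m) mod int n) ` S)))"
proof -
  have "half_orbit_circulant m S"
    using assms(2,4,5,7,9,11) unfolding assms(1) by (simp add: half_orbit_circulant_def)
  note * = half_orbit_circulant.digraph_iso_translate[OF this]
  note a = assms(13-19)[unfolded assms(1,12)]
  show ?thesis unfolding assms(1) by (rule *[OF a])
qed

end
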